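(* Let $R$ be a non-local commutative Artinian ring with unity. Then the upper ideal relation graph $\Gamma_U(R)$ is the complement of a line graph if and only if $R$ is isomorphic to one of the following six rings: $\mathbb{Z}_2\times\mathbb{Z}_2\times\mathbb{Z}_2$, $\mathbb{Z}_2\times\mathbb{Z}_2$, $\mathbb{Z}_2\times\mathbb{Z}_3$, $\mathbb{Z}_2\times\mathbb{Z}_4$, $\mathbb{Z}_2\times\frac{\mathbb{Z}_2[x]}{(x^2)}$, $\mathbb{Z}_3\times\mathbb{Z}_3$.
   Context: For a commutative ring $R$ with unity, the upper ideal relation graph $\Gamma_U(R)$ is the simple undirected graph whose vertex set is the set of all non-unit elements of $R$, two distinct vertices $x,y$ being adjacent if and only if there is a non-unit element $z\in R$ such that the principal ideals $(x)$ and $(y)$ are both contained in the principal ideal $(z)$. The line graph $L(H)$ of a simple undirected graph $H$ has vertex set $E(H)$, and two distinct vertices of $L(H)$ are adjacent if and only if the corresponding edges share a common vertex in $H$. The complement $\overline{\Gamma}$ of a graph $\Gamma$ has the same vertex set, with two distinct vertices adjacent in $\overline{\Gamma}$ if and only if they are not adjacent in $\Gamma$. A graph is "the complement of a line graph" if it is isomorphic to $\overline{L(H)}$ for some simple undirected graph $H$. A ring is local if it has exactly one maximal ideal. $\mathbb{Z}_n$ denotes the ring of integers modulo $n$. *)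

theory Defs
  imports
    "HOL-Algebra.Algebra"
    "HOL-Number_Theory.Residues"
begin

section \<open>Simple undirected graphs, possibly infinite\<close>

record 'v ugraph =
  verts :: "'v set"
  edges :: "'v set set"

definition simple_graph :: "'v ugraph \<Rightarrow> bool"
  where "simple_graph G \<longleftrightarrow>
    (\<forall>e \<in> edges G. \<exists>u \<in> verts G. \<exists>v \<in> verts G. u \<noteq> v \<and> e = {u, v})"

definition graph_isomorphic :: "'v ugraph \<Rightarrow> 'w ugraph \<Rightarrow> bool"
  where "graph_isomorphic G H \<longleftrightarrow>
    (\<exists>f. bij_betw f (verts G) (verts H) \<and>
         (\<forall>u \<in> verts G. \<forall>v \<in> verts G. {u, v} \<in> edges G \<longleftrightarrow> {f u, f v} \<in> edges H))"

definition graph_complement :: "'v ugraph \<Rightarrow> 'v ugraph"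
  where "graph_complement G =
    \<lparr> verts = verts G,
      edges = {{u, v} |u v. u \<in> verts G \<and> v \<in> verts G \<and> u \<noteq> v \<and> {u, v} \<notin> edges G} \<rparr>"

definition line_graph :: "'v ugraph \<Rightarrow> 'v set ugraph"
  where "line_graph H =
    \<lparr> verts = edges H,
      edges = {{e, f} |e f. e \<in> edges H \<and> f \<in> edges H \<and> e \<noteq> f \<and> e \<inter> f \<noteq> {}} \<rparr>"

text \<open>
  HOL cannot quantify over the type of the vertices of \<open>H\<close>, so a type has to be chosen.
  Isolated vertices of \<open>H\<close> do not affect its line graph, and every other vertex is one of the
  two ends of an edge, i.e. of a vertex of \<open>G\<close>; hence \<open>'v \<times> bool\<close> is large enough.
  Lemma \<open>complement_of_line_graphI\<close> below shows that an \<open>H\<close> over any type will do.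
\<close>
definition complement_of_line_graph :: "'v ugraph \<Rightarrow> bool"
  where "complement_of_line_graph G \<longleftrightarrow>
    (\<exists>H :: ('v \<times> bool) ugraph.
       simple_graph H \<and> graph_isomorphic G (graph_complement (line_graph H)))"

lemma complement_of_line_graphI:
  fixes G :: "'v ugraph" and H :: "'w ugraph"
  assumes "simple_graph H" and "graph_isomorphic G (graph_complement (line_graph H))"
  shows "complement_of_line_graph G"
proof -
  have edge_iff: "{e, e'} \<in> edges (graph_complement (line_graph K))
      \<longleftrightarrow> e \<noteq> e' \<and> e \<inter> e' = {}"
    if "e \<in> edges K" "e' \<in> edges K" for K :: "'z ugraph" and e e'
    using that by (auto simp: graph_complement_def line_graph_def doubleton_eq_iff)
  obtain f where f: "bij_betw f (verts G) (edges H)"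
    and adj: "\<And>u v. u \<in> verts G \<Longrightarrow> v \<in> verts G \<Longrightarrow>
      {u, v} \<in> edges G \<longleftrightarrow> {f u, f v} \<in> edges (graph_complement (line_graph H))"
    using assms(2) unfolding graph_isomorphic_def
    by (auto simp: graph_complement_def line_graph_def)
  define W where "W = \<Union> (edges H)"
  define p where "p e = (SOME x. x \<in> e)" for e :: "'w set"
  define c where "c w = (SOME v. v \<in> verts G \<and> w \<in> f v)" for w
  define g where "g w = (c w, w = p (f (c w)))" for w
  have c: "c w \<in> verts G \<and> w \<in> f (c w)" if "w \<in> W" for w
  proof -
    have "\<exists>v. v \<in> verts G \<and> w \<in> f v"
      using that f unfolding W_def bij_betw_def by blast
    then show ?thesis unfolding c_def by (rule someI_ex)
  qed
  have pe: "p e \<in> e" if "e \<in> edges H" for e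
  proof -
    have "\<exists>x. x \<in> e" using that assms(1) unfolding simple_graph_def by blast
    then show ?thesis unfolding p_def by (rule someI_ex)
  qed
  have inj: "inj_on g W"
  proof (rule inj_onI)
    fix w w' assume ww: "w \<in> W" "w' \<in> W" and eq: "g w = g w'"
    define e where "e = f (c w)"
    have "e \<in> edges H" using c[OF ww(1)] f unfolding e_def bij_betw_def by blast
    moreover obtain a b where "e = {a, b}"
      using calculation assms(1) unfolding simple_graph_def by blast
    moreover have "w \<in> e" "w' \<in> e" using c[OF ww(1)] c[OF ww(2)] eq
      unfolding e_def g_def by auto
    moreover have "w = p e \<longleftrightarrow> w' = p e" using eq unfolding e_def g_def by auto
    ultimately show "w = w'" using pe[of e] by auto
  qed
  define H' :: "('v \<times> bool) ugraph"
    where "H' = \<lparr> verts = g ` W, edges = (`) g ` edges H \<rparr>"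
  have sub: "e \<subseteq> W" if "e \<in> edges H" for e using that unfolding W_def by blast
  have "simple_graph H'"
    unfolding simple_graph_def
  proof
    fix e' assume "e' \<in> edges H'"
    then obtain e where e: "e \<in> edges H" "e' = g ` e" unfolding H'_def by auto
    then obtain u v where uv: "u \<noteq> v" "e = {u, v}"
      using assms(1) unfolding simple_graph_def by blast
    then have "u \<in> W" "v \<in> W" using sub[OF e(1)] by auto
    then have "g u \<noteq> g v" using inj uv(1) by (auto dest: inj_onD)
    then show "\<exists>u \<in> verts H'. \<exists>v \<in> verts H'. u \<noteq> v \<and> e' = {u, v}"
      using \<open>u \<in> W\<close> \<open>v \<in> W\<close> e uv unfolding H'_def by auto
  qed
  moreover have "graph_isomorphic G (graph_complement (line_graph H'))"
    unfolding graph_isomorphic_def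
  proof (intro exI[of _ "\<lambda>v. g ` f v"] conjI ballI)
    have inj': "inj_on ((`) g) (edges H)"
      using inj sub by (auto intro!: inj_onI simp: inj_on_image_eq_iff)
    have "bij_betw ((`) g \<circ> f) (verts G) ((`) g ` edges H)"
      using f inj' by (intro bij_betw_trans[OF f]) (auto simp: bij_betw_def)
    then show "bij_betw (\<lambda>v. g ` f v) (verts G) (verts (graph_complement (line_graph H')))"
      by (simp add: graph_complement_def line_graph_def H'_def comp_def)
  next
    fix u v assume uv: "u \<in> verts G" "v \<in> verts G"
    have E: "f u \<in> edges H" "f v \<in> edges H" using f uv unfolding bij_betw_def by auto
    then have E': "g ` f u \<in> edges H'" "g ` f v \<in> edges H'" unfolding H'_def by auto
    have "g ` f u = g ` f v \<longleftrightarrow> f u = f v"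
      using inj sub[OF E(1)] sub[OF E(2)] by (rule inj_on_image_eq_iff)
    moreover have "g ` f u \<inter> g ` f v = g ` (f u \<inter> f v)"
      using inj_on_image_Int[OF inj sub[OF E(1)] sub[OF E(2)]] by simp
    ultimately show "{u, v} \<in> edges G \<longleftrightarrow>
        {g ` f u, g ` f v} \<in> edges (graph_complement (line_graph H'))"
      using adj[OF uv] edge_iff[OF E] edge_iff[OF E'] by simp
  qed
  ultimately show ?thesis unfolding complement_of_line_graph_def by blast
qed

section \<open>Rings\<close>

locale artinian_cring = cring +
  assumes descending_chain_condition:
    "(\<And>n :: nat. ideal (I n) R) \<Longrightarrow> (\<And>n. I (Suc n) \<subseteq> I n) \<Longrightarrow> \<exists>n. \<forall>m \<ge> n. I m = I n"

definition is_local_ring :: "('a, 'b) ring_scheme \<Rightarrow> bool"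
  where "is_local_ring R \<longleftrightarrow> (\<exists>!M. maximalideal M R)"

definition upper_ideal_relation_graph :: "('a, 'b) ring_scheme \<Rightarrow> 'a ugraph"
  where "upper_ideal_relation_graph R =
    \<lparr> verts = carrier R - Units R,
      edges = {{x, y} |x y. x \<in> carrier R - Units R \<and> y \<in> carrier R - Units R \<and> x \<noteq> y \<and>
        (\<exists>z \<in> carrier R - Units R. PIdl\<^bsub>R\<^esub> x \<subseteq> PIdl\<^bsub>R\<^esub> z \<and> PIdl\<^bsub>R\<^esub> y \<subseteq> PIdl\<^bsub>R\<^esub> z)} \<rparr>"

definition Z2_X_mod_X2 :: "int list set ring"
  where "Z2_X_mod_X2 =
    (let P = poly_ring (residue_ring 2)
     in P Quot (PIdl\<^bsub>P\<^esub> (X\<^bsub>residue_ring 2\<^esub> [^]\<^bsub>P\<^esub> (2 :: nat))))"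

end

theory Submission
  imports Defs
begin

text \<open>
  Two non-units are adjacent iff they have a common non-unit divisor. In the complement of a line
  graph, pairwise adjacent vertices are pairwise disjoint edges, and at most two of them meet a given
  edge; so no vertex is non-adjacent to all three vertices of a triangle (a claw in the complement).
  This alone forces the classification. If \<open>x\<close> and \<open>1 - x\<close> are non-units, \<open>1 - x\<close> and the powers
  \<open>x, x\<^sup>2, x\<^sup>3\<close> must not be a claw, so \<open>x\<^sup>2\<close> is a non-trivial idempotent and \<open>R\<close> splits as \<open>A \<times> B\<close>. For
  a non-unit \<open>m\<close> of \<open>B\<close>, the elements of \<open>U(A) \<times> (m)\<close> are pairwise adjacent and none is adjacent to
  \<open>(0, 1)\<close>, hence \<open>|U(A)| |(m)| \<le> 2\<close>. If one factor splits further, every factor has two elements;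
  otherwise each factor has at most four elements. Conversely, the edges of a 4-cycle (of a spider
  with three legs for three factors), together with isolated edges, represent the graphs of the six
  rings.
\<close>

section \<open>Claws in complements of line graphs\<close>

text \<open>The constant 2 comes from the two ends of an edge. Claws arise from comaximality:
  multiples of one non-unit are pairwise adjacent, whereas two elements generating the unit ideal
  have no common non-unit divisor. Thus \<open>1 - x\<close> is the centre against all powers of
  \<open>x\<close>, since it divides \<open>1 - x^n\<close>. The idempotent \<open>x^2\<close> is
  non-trivial because \<open>x^2 = 1\<close> makes \<open>x\<close> a unit and
  \<open>x^2 = 0\<close> makes \<open>1 - x\<close> one. In a product the centre
  \<open>(0, 1)\<close> allows counting elements instead of powers, and since every infinite set has
  three-element subsets, the same argument yields finiteness. Taking \<open>m = 0\<close> in the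
  resulting bound leaves each factor at most two units; taking \<open>m \<noteq> 0\<close> leaves
  only the unit 1 opposite a factor with a nonzero non-unit. In the converse the 2 returns: two
  opposite edges of a 4-cycle carry the vertices lying in exactly one given maximal ideal.\<close>

lemma graph_complement_line_graph_edge_iff:
  assumes "e \<in> edges H" "e' \<in> edges H"
  shows "{e, e'} \<in> edges (graph_complement (line_graph H)) \<longleftrightarrow> e \<noteq> e' \<and> e \<inter> e' = {}"
  using assms by (auto simp: graph_complement_def line_graph_def doubleton_eq_iff)

text \<open>Forgets the host graph: what remains is a labelling of the vertices by two-element sets
  in which adjacency is disjointness. All later arguments use only such labellings.\<close>

lemma complement_of_line_graphD:
  assumes "complement_of_line_graph (G :: 'v ugraph)"
  shows "\<exists>f :: 'v \<Rightarrow> ('v \<times> bool) set. inj_on f (verts G) \<and>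
    (\<forall>v \<in> verts G. \<exists>p q. p \<noteq> q \<and> f v = {p, q}) \<and>
    (\<forall>u \<in> verts G. \<forall>v \<in> verts G. {u, v} \<in> edges G \<longleftrightarrow> u \<noteq> v \<and> f u \<inter> f v = {})"
proof -
  obtain H :: "('v \<times> bool) ugraph" and f where H: "simple_graph H"
    and f: "bij_betw f (verts G) (edges H)"
    and adj: "\<forall>u \<in> verts G. \<forall>v \<in> verts G.
      {u, v} \<in> edges G \<longleftrightarrow> {f u, f v} \<in> edges (graph_complement (line_graph H))"
    using assms unfolding complement_of_line_graph_def graph_isomorphic_def
    by (auto simp: graph_complement_def line_graph_def)
  have mem: "f v \<in> edges H" if "v \<in> verts G" for v
    using f that unfolding bij_betw_def by blast
  have inj: "inj_on f (verts G)" using f unfolding bij_betw_def by blast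
  have "{f u, f v} \<in> edges (graph_complement (line_graph H)) \<longleftrightarrow> u \<noteq> v \<and> f u \<inter> f v = {}"
    if "u \<in> verts G" "v \<in> verts G" for u v
    using graph_complement_line_graph_edge_iff[OF mem[OF that(1)] mem[OF that(2)]]
      inj_on_eq_iff[OF inj that] by simp
  moreover have "\<exists>p q. p \<noteq> q \<and> f v = {p, q}" if "v \<in> verts G" for v
    using H mem[OF that] unfolding simple_graph_def by blast
  ultimately show ?thesis using inj adj by blast
qed

text \<open>The label type \<open>'w\<close> is free, so that a construction can pick integers or a
  sum type as ends of its edges.\<close>

lemma complement_of_line_graph_pairsI:
  fixes G :: "'v ugraph" and f :: "'v \<Rightarrow> 'w set"
  assumes inj: "inj_on f (verts G)"
    and pair: "\<And>v. v \<in> verts G \<Longrightarrow> \<exists>p q. p \<noteq> q \<and> f v = {p, q}"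
    and adj: "\<And>u v. u \<in> verts G \<Longrightarrow> v \<in> verts G \<Longrightarrow>
      {u, v} \<in> edges G \<longleftrightarrow> u \<noteq> v \<and> f u \<inter> f v = {}"
  shows "complement_of_line_graph G"
proof (rule complement_of_line_graphI)
  let ?H = "\<lparr> verts = UNIV, edges = f ` verts G \<rparr> :: 'w ugraph"
  show "simple_graph ?H" using pair by (force simp: simple_graph_def)
  show "graph_isomorphic G (graph_complement (line_graph ?H))"
    unfolding graph_isomorphic_def
  proof (intro exI[of _ f] conjI ballI)
    show "bij_betw f (verts G) (verts (graph_complement (line_graph ?H)))"
      using inj by (simp add: bij_betw_def graph_complement_def line_graph_def)
    fix u v assume uv: "u \<in> verts G" "v \<in> verts G"
    show "{u, v} \<in> edges G \<longleftrightarrow> {f u, f v} \<in> edges (graph_complement (line_graph ?H))"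
      using graph_complement_line_graph_edge_iff[of "f u" ?H "f v"] uv inj_on_eq_iff[OF inj uv]
      by (simp add: adj)
  qed
qed

text \<open>Pigeonhole: three pairwise disjoint sets would need three different points of
  \<open>{p, q}\<close>.\<close>

lemma card_3_no_disjoint_transversal:
  assumes "card T = 3" and "\<And>x. x \<in> T \<Longrightarrow> f x \<inter> {p, q} \<noteq> {}"
    and "\<And>x y. x \<in> T \<Longrightarrow> y \<in> T \<Longrightarrow> x \<noteq> y \<Longrightarrow> f x \<inter> f y = {}"
  shows False
proof -
  obtain x y z where T: "T = {x, y, z}" "x \<noteq> y" "x \<noteq> z" "y \<noteq> z"
    using assms(1) by (auto simp: card_3_iff)
  have "f x \<inter> f y = {}" "f x \<inter> f z = {}" "f y \<inter> f z = {}"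
    using T assms(3) by auto
  moreover have "f x \<inter> {p, q} \<noteq> {}" "f y \<inter> {p, q} \<noteq> {}" "f z \<inter> {p, q} \<noteq> {}"
    using T assms(2) by auto
  ultimately show False by blast
qed

section \<open>Adjacency as existence of a common non-unit divisor\<close>

text \<open>Adjacency without the condition \<open>x \<noteq> y\<close>, and meaningful for units
  too, where it is false. In a product one coordinate of a non-unit may be a unit, so only this form
  can be evaluated coordinatewise.\<close>

definition common_nonunit_divisor :: "('a, 'b) ring_scheme \<Rightarrow> 'a \<Rightarrow> 'a \<Rightarrow> bool"
  where "common_nonunit_divisor R x y \<longleftrightarrow>
    (\<exists>z \<in> carrier R - Units R. \<exists>r \<in> carrier R. \<exists>s \<in> carrier R.
      x = r \<otimes>\<^bsub>R\<^esub> z \<and> y = s \<otimes>\<^bsub>R\<^esub> z)"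

text \<open>The claw lives in the complement graph: \<open>a\<close> is its centre and the triangle
  \<open>T\<close> its set of leaves. Reflexivity of \<open>common_nonunit_divisor\<close> on
  non-units keeps \<open>a\<close> out of \<open>T\<close>.\<close>

definition claw_free :: "('a, 'b) ring_scheme \<Rightarrow> bool"
  where "claw_free R \<longleftrightarrow> \<not> (\<exists>a \<in> carrier R - Units R. \<exists>T \<subseteq> carrier R - Units R. card T = 3 \<and>
    (\<forall>x \<in> T. \<forall>y \<in> T. x \<noteq> y \<longrightarrow> common_nonunit_divisor R x y) \<and>
    (\<forall>x \<in> T. \<not> common_nonunit_divisor R a x))"

lemma verts_upper_ideal_relation_graph [simp]:
  "verts (upper_ideal_relation_graph R) = carrier R - Units R"
  by (simp add: upper_ideal_relation_graph_def)

context cring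
begin

lemma common_nonunit_divisor_self:
  assumes "x \<in> carrier R - Units R"
  shows "common_nonunit_divisor R x x"
  using assms unfolding common_nonunit_divisor_def by (intro bexI[of _ x] bexI[of _ \<one>]) auto

lemma PIdl_subset_iff:
  assumes "x \<in> carrier R" "z \<in> carrier R"
  shows "PIdl x \<subseteq> PIdl z \<longleftrightarrow> (\<exists>r \<in> carrier R. x = r \<otimes> z)"
proof
  assume "PIdl x \<subseteq> PIdl z"
  then show "\<exists>r \<in> carrier R. x = r \<otimes> z"
    using cgenideal_self[OF assms(1)] unfolding cgenideal_def by blast
next
  assume "\<exists>r \<in> carrier R. x = r \<otimes> z"
  then have "x \<in> PIdl z" unfolding cgenideal_def by blast
  then show "PIdl x \<subseteq> PIdl z"
    by (rule cgenideal_minimal[OF cgenideal_ideal[OF assms(2)]])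
qed

lemma upper_ideal_relation_graph_edge_iff:
  assumes "x \<in> carrier R - Units R" "y \<in> carrier R - Units R"
  shows "{x, y} \<in> edges (upper_ideal_relation_graph R) \<longleftrightarrow>
    x \<noteq> y \<and> common_nonunit_divisor R x y"
proof -
  have "{x, y} \<in> edges (upper_ideal_relation_graph R) \<longleftrightarrow>
    x \<noteq> y \<and> (\<exists>z \<in> carrier R - Units R. PIdl x \<subseteq> PIdl z \<and> PIdl y \<subseteq> PIdl z)"
    using assms unfolding upper_ideal_relation_graph_def
    by (auto simp: doubleton_eq_iff)
  also have "\<dots> \<longleftrightarrow> x \<noteq> y \<and> common_nonunit_divisor R x y"
    using assms by (auto simp: PIdl_subset_iff common_nonunit_divisor_def)
  finally show ?thesis .
qed

text \<open>The labels of the leaves are pairwise disjoint, yet each must meet the two-element label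
  of the centre.\<close>

lemma complement_of_line_graph_imp_claw_free:
  assumes "complement_of_line_graph (upper_ideal_relation_graph R)"
  shows "claw_free R"
  unfolding claw_free_def
proof (intro notI, elim bexE exE conjE)
  fix a T
  assume a: "a \<in> carrier R - Units R" and T: "T \<subseteq> carrier R - Units R" "card T = 3"
    "\<forall>x \<in> T. \<forall>y \<in> T. x \<noteq> y \<longrightarrow> common_nonunit_divisor R x y"
    "\<forall>x \<in> T. \<not> common_nonunit_divisor R a x"
  obtain f :: "'a \<Rightarrow> ('a \<times> bool) set"
    where pair: "\<And>v. v \<in> carrier R - Units R \<Longrightarrow> \<exists>p q. p \<noteq> q \<and> f v = {p, q}"
    and adj: "\<And>u v. u \<in> carrier R - Units R \<Longrightarrow> v \<in> carrier R - Units R \<Longrightarrow>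
      {u, v} \<in> edges (upper_ideal_relation_graph R) \<longleftrightarrow> u \<noteq> v \<and> f u \<inter> f v = {}"
    using complement_of_line_graphD[OF assms] unfolding verts_upper_ideal_relation_graph by metis
  have adj: "common_nonunit_divisor R u v \<longleftrightarrow> f u \<inter> f v = {}"
    if "u \<in> carrier R - Units R" "v \<in> carrier R - Units R" "u \<noteq> v" for u v
    using adj[OF that(1,2)] upper_ideal_relation_graph_edge_iff[OF that(1,2)] that(3) by simp
  obtain p q where pq: "f a = {p, q}" using pair[OF a] by blast
  show False
  proof (rule card_3_no_disjoint_transversal[OF T(2), where f = f and p = p and q = q])
    fix x assume x: "x \<in> T"
    then have "x \<noteq> a" using T(4) common_nonunit_divisor_self[OF a] by auto
    then have "f a \<inter> f x \<noteq> {}" using adj[OF a, of x] x T(1,4) by blast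
    then show "f x \<inter> {p, q} \<noteq> {}" using pq by blast
  next
    fix x y assume "x \<in> T" "y \<in> T" "x \<noteq> y"
    then show "f x \<inter> f y = {}" using adj T(1,3) by blast
  qed
qed

lemma complement_of_line_graph_ringI:
  assumes inj: "inj_on f (carrier R - Units R)"
    and pair: "\<And>v. v \<in> carrier R - Units R \<Longrightarrow> \<exists>p q. p \<noteq> q \<and> f v = {p, q}"
    and adj: "\<And>u v. u \<in> carrier R - Units R \<Longrightarrow> v \<in> carrier R - Units R \<Longrightarrow> u \<noteq> v \<Longrightarrow>
      common_nonunit_divisor R u v \<longleftrightarrow> f u \<inter> f v = {}"
  shows "complement_of_line_graph (upper_ideal_relation_graph R)"
proof (rule complement_of_line_graph_pairsI[of f])
  fix u v
  assume uv: "u \<in> verts (upper_ideal_relation_graph R)" "v \<in> verts (upper_ideal_relation_graph R)"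
  then show "{u, v} \<in> edges (upper_ideal_relation_graph R) \<longleftrightarrow> u \<noteq> v \<and> f u \<inter> f v = {}"
    using adj[of u v] upper_ideal_relation_graph_edge_iff[of u v] by auto
qed (use inj pair in simp_all)

end

section \<open>Invariance under ring isomorphism\<close>

lemma ring_hom_Units:
  assumes "h \<in> ring_hom R S" "x \<in> Units R"
  shows "h x \<in> Units S"
proof -
  obtain y where "x \<in> carrier R" "y \<in> carrier R" "y \<otimes>\<^bsub>R\<^esub> x = \<one>\<^bsub>R\<^esub>" "x \<otimes>\<^bsub>R\<^esub> y = \<one>\<^bsub>R\<^esub>"
    using assms(2) unfolding Units_def by blast
  moreover from this have "h y \<otimes>\<^bsub>S\<^esub> h x = \<one>\<^bsub>S\<^esub>" "h x \<otimes>\<^bsub>S\<^esub> h y = \<one>\<^bsub>S\<^esub>"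
    using ring_hom_memE(2,4)[OF assms(1)] by metis+
  ultimately show ?thesis using ring_hom_memE(1)[OF assms(1)] unfolding Units_def by blast
qed

lemma (in ring) ring_iso_inverse:
  assumes "h \<in> ring_iso R S"
  shows "inv_into (carrier R) h \<in> ring_iso S R"
    and "\<And>x. x \<in> carrier R \<Longrightarrow> inv_into (carrier R) h (h x) = x"
    and "\<And>y. y \<in> carrier S \<Longrightarrow> h (inv_into (carrier R) h y) = y"
  using ring_iso_set_sym[OF ring_axioms assms] ring_iso_memE(5)[OF assms]
  by (auto simp: bij_betw_def f_inv_into_f)

lemma (in ring) ring_iso_Units_iff:
  assumes "h \<in> ring_iso R S" "x \<in> carrier R"
  shows "h x \<in> Units S \<longleftrightarrow> x \<in> Units R"
  using ring_hom_Units[of h R S x] ring_hom_Units[of "inv_into (carrier R) h" S R "h x"]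
    ring_iso_inverse[OF assms(1)] assms unfolding ring_iso_def by auto

lemma (in ring) ring_iso_common_nonunit_divisor_iff:
  assumes h: "h \<in> ring_iso R S" and x: "x \<in> carrier R" and y: "y \<in> carrier R"
  shows "common_nonunit_divisor S (h x) (h y) \<longleftrightarrow> common_nonunit_divisor R x y"
proof
  assume "common_nonunit_divisor R x y"
  then obtain z r s where *: "z \<in> carrier R" "z \<notin> Units R" "r \<in> carrier R" "s \<in> carrier R"
    "x = r \<otimes> z" "y = s \<otimes> z" unfolding common_nonunit_divisor_def by blast
  show "common_nonunit_divisor S (h x) (h y)"
    unfolding common_nonunit_divisor_def
    by (rule bexI[of _ "h z"], rule bexI[of _ "h r"], rule bexI[of _ "h s"])
      (use * ring_iso_memE[OF h] ring_iso_Units_iff[OF h] in auto)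
next
  let ?g = "inv_into (carrier R) h"
  note g = ring_iso_inverse[OF h]
  assume "common_nonunit_divisor S (h x) (h y)"
  then obtain z r s where *: "z \<in> carrier S" "z \<notin> Units S" "r \<in> carrier S" "s \<in> carrier S"
    "h x = r \<otimes>\<^bsub>S\<^esub> z" "h y = s \<otimes>\<^bsub>S\<^esub> z" unfolding common_nonunit_divisor_def by blast
  have gz: "?g z \<in> carrier R" using *(1) ring_iso_memE(1)[OF g(1)] by blast
  then have "?g z \<notin> Units R" using *(1,2) g(3) ring_iso_Units_iff[OF h gz] by simp
  moreover have "x = ?g r \<otimes> ?g z" "y = ?g s \<otimes> ?g z"
    using * g(2)[OF x] g(2)[OF y] ring_iso_memE(2)[OF g(1)] by metis+
  ultimately show "common_nonunit_divisor R x y"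
    unfolding common_nonunit_divisor_def using gz *(3,4) ring_iso_memE(1)[OF g(1)] by blast
qed

lemma (in ring) ring_iso_claw_free:
  assumes h: "h \<in> ring_iso R S" and cf: "claw_free R"
  shows "claw_free S"
  unfolding claw_free_def
proof (intro notI, elim bexE exE conjE)
  fix a T
  assume a: "a \<in> carrier S - Units S" and T: "T \<subseteq> carrier S - Units S" "card T = 3"
    "\<forall>x \<in> T. \<forall>y \<in> T. x \<noteq> y \<longrightarrow> common_nonunit_divisor S x y"
    "\<forall>x \<in> T. \<not> common_nonunit_divisor S a x"
  let ?g = "inv_into (carrier R) h"
  note g = ring_iso_inverse[OF h]
  have gn: "?g x \<in> carrier R - Units R" if "x \<in> carrier S - Units S" for x
    using that ring_iso_memE(1)[OF g(1), of x] g(3)[of x] ring_iso_Units_iff[OF h, of "?g x"] by simp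
  have gc: "common_nonunit_divisor R (?g x) (?g y) \<longleftrightarrow> common_nonunit_divisor S x y"
    if "x \<in> carrier S - Units S" "y \<in> carrier S - Units S" for x y
    using that gn[OF that(1)] gn[OF that(2)] g(3) ring_iso_common_nonunit_divisor_iff[OF h, of "?g x" "?g y"]
    by simp
  have "inj_on ?g T"
    using ring_iso_memE(5)[OF g(1)] T(1) unfolding bij_betw_def by (blast intro: inj_on_subset)
  then have "card (?g ` T) = 3" using T(2) by (simp add: card_image)
  moreover have "?g ` T \<subseteq> carrier R - Units R" using gn T(1) by blast
  moreover have "\<forall>x \<in> ?g ` T. \<forall>y \<in> ?g ` T. x \<noteq> y \<longrightarrow> common_nonunit_divisor R x y"
  proof (intro ballI impI)
    fix u v assume "u \<in> ?g ` T" "v \<in> ?g ` T" "u \<noteq> v"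
    then obtain x y where "u = ?g x" "v = ?g y" "x \<in> T" "y \<in> T" "x \<noteq> y" by blast
    then show "common_nonunit_divisor R u v" using gc[of x y] T(1,3) by blast
  qed
  moreover have "\<forall>x \<in> ?g ` T. \<not> common_nonunit_divisor R (?g a) x"
  proof
    fix u assume "u \<in> ?g ` T"
    then obtain x where "u = ?g x" "x \<in> T" by blast
    then show "\<not> common_nonunit_divisor R (?g a) u" using gc[OF a, of x] T(1,4) by blast
  qed
  ultimately have "\<not> claw_free R"
    unfolding claw_free_def not_not
    by (intro bexI[OF _ gn[OF a]] exI[of _ "?g ` T"] conjI)
  then show False using cf by simp
qed

lemma ring_iso_complement_of_line_graph:
  assumes "cring R" "cring S" and h: "h \<in> ring_iso R S"
    and "complement_of_line_graph (upper_ideal_relation_graph S)"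
  shows "complement_of_line_graph (upper_ideal_relation_graph (R :: ('a, 'b) ring_scheme))"
proof -
  interpret R: cring R by fact
  interpret S: cring S by fact
  obtain f :: "'c \<Rightarrow> ('c \<times> bool) set" where f: "inj_on f (carrier S - Units S)"
    "\<And>v. v \<in> carrier S - Units S \<Longrightarrow> \<exists>p q. p \<noteq> q \<and> f v = {p, q}"
    "\<And>u v. u \<in> carrier S - Units S \<Longrightarrow> v \<in> carrier S - Units S \<Longrightarrow>
      {u, v} \<in> edges (upper_ideal_relation_graph S) \<longleftrightarrow> u \<noteq> v \<and> f u \<inter> f v = {}"
    using complement_of_line_graphD[OF assms(4)] unfolding verts_upper_ideal_relation_graph by metis
  have hn: "h x \<in> carrier S - Units S" if "x \<in> carrier R - Units R" for x
    using that ring_iso_memE(1)[OF h] R.ring_iso_Units_iff[OF h] by blast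
  have hi: "inj_on h (carrier R)" using ring_iso_memE(5)[OF h] unfolding bij_betw_def by blast
  show ?thesis
  proof (rule R.complement_of_line_graph_ringI[where f = "f \<circ> h"])
    show "inj_on (f \<circ> h) (carrier R - Units R)"
      using hi f(1) hn
      by (intro comp_inj_on) (auto intro: inj_on_subset simp: image_subset_iff)
  next
    fix v assume "v \<in> carrier R - Units R"
    then show "\<exists>p q. p \<noteq> q \<and> (f \<circ> h) v = {p, q}" using f(2) hn by simp
  next
    fix u v assume uv: "u \<in> carrier R - Units R" "v \<in> carrier R - Units R" "u \<noteq> v"
    have "h u \<noteq> h v" using uv hi by (auto dest: inj_onD)
    then show "common_nonunit_divisor R u v \<longleftrightarrow> (f \<circ> h) u \<inter> (f \<circ> h) v = {}"
      using f(3)[OF hn hn, OF uv(1,2)] S.upper_ideal_relation_graph_edge_iff[OF hn hn, OF uv(1,2)]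
        R.ring_iso_common_nonunit_divisor_iff[OF h, of u v] uv by auto
  qed
qed

section \<open>Direct products\<close>

lemma RDirProd_simps [simp]:
  "carrier (RDirProd A B) = carrier A \<times> carrier B"
  "(a, b) \<otimes>\<^bsub>RDirProd A B\<^esub> (c, d) = (a \<otimes>\<^bsub>A\<^esub> c, b \<otimes>\<^bsub>B\<^esub> d)"
  "(a, b) \<oplus>\<^bsub>RDirProd A B\<^esub> (c, d) = (a \<oplus>\<^bsub>A\<^esub> c, b \<oplus>\<^bsub>B\<^esub> d)"
  "\<one>\<^bsub>RDirProd A B\<^esub> = (\<one>\<^bsub>A\<^esub>, \<one>\<^bsub>B\<^esub>)"
  "\<zero>\<^bsub>RDirProd A B\<^esub> = (\<zero>\<^bsub>A\<^esub>, \<zero>\<^bsub>B\<^esub>)"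
  by (auto simp: RDirProd_def DirProd_def monoid.defs)

lemma RDirProd_cring:
  assumes "cring A" "cring B"
  shows "cring (RDirProd A B)"
proof -
  interpret A: cring A by fact
  interpret B: cring B by fact
  interpret ring "RDirProd A B" by (rule RDirProd_ring[OF A.ring_axioms B.ring_axioms])
  show ?thesis by unfold_locales (auto simp: A.m_comm B.m_comm)
qed

lemma Units_RDirProd: "Units (RDirProd A B) = Units A \<times> Units B"
  unfolding Units_def by auto blast+

lemma (in cring) not_common_nonunit_divisor_unit:
  assumes "u \<in> Units R"
  shows "\<not> common_nonunit_divisor R x u" "\<not> common_nonunit_divisor R u x"
  using assms unit_factor m_comm unfolding common_nonunit_divisor_def by (metis DiffE)+

text \<open>A pair is a non-unit as soon as one coordinate is. A common divisor \<open>z\<close> in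
  one factor therefore extends by 1 in the other, where the coordinates themselves serve as
  cofactors.\<close>

lemma RDirProd_common_nonunit_divisor:
  assumes "cring A" "cring B" and "a \<in> carrier A" "a' \<in> carrier A" "b \<in> carrier B" "b' \<in> carrier B"
  shows "common_nonunit_divisor (RDirProd A B) (a, b) (a', b') \<longleftrightarrow>
    common_nonunit_divisor A a a' \<or> common_nonunit_divisor B b b'"
proof -
  interpret A: cring A by fact
  interpret B: cring B by fact
  show ?thesis
  proof
    assume "common_nonunit_divisor (RDirProd A B) (a, b) (a', b')"
    then obtain Z P Q where Z: "Z \<in> carrier (RDirProd A B)" "Z \<notin> Units (RDirProd A B)"
      "P \<in> carrier (RDirProd A B)" "Q \<in> carrier (RDirProd A B)"
      "(a, b) = P \<otimes>\<^bsub>RDirProd A B\<^esub> Z" "(a', b') = Q \<otimes>\<^bsub>RDirProd A B\<^esub> Z"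
      unfolding common_nonunit_divisor_def by blast
    obtain z w r r' s s' where ZPQ: "Z = (z, w)" "P = (r, r')" "Q = (s, s')" by (metis surj_pair)
    have *: "z \<in> carrier A" "w \<in> carrier B" "z \<notin> Units A \<or> w \<notin> Units B"
      "r \<in> carrier A" "s \<in> carrier A" "r' \<in> carrier B" "s' \<in> carrier B"
      "a = r \<otimes>\<^bsub>A\<^esub> z" "a' = s \<otimes>\<^bsub>A\<^esub> z" "b = r' \<otimes>\<^bsub>B\<^esub> w" "b' = s' \<otimes>\<^bsub>B\<^esub> w"
      using Z unfolding ZPQ by (simp_all add: Units_RDirProd)
    show "common_nonunit_divisor A a a' \<or> common_nonunit_divisor B b b'"
      using *(3)
    proof
      assume "z \<notin> Units A"
      then have "common_nonunit_divisor A a a'" using * unfolding common_nonunit_divisor_def by blast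
      then show ?thesis ..
    next
      assume "w \<notin> Units B"
      then have "common_nonunit_divisor B b b'" using * unfolding common_nonunit_divisor_def by blast
      then show ?thesis ..
    qed
  next
    assume "common_nonunit_divisor A a a' \<or> common_nonunit_divisor B b b'"
    then show "common_nonunit_divisor (RDirProd A B) (a, b) (a', b')"
    proof
      assume "common_nonunit_divisor A a a'"
      then obtain z r s where "z \<in> carrier A" "z \<notin> Units A" "r \<in> carrier A" "s \<in> carrier A"
        "a = r \<otimes>\<^bsub>A\<^esub> z" "a' = s \<otimes>\<^bsub>A\<^esub> z" unfolding common_nonunit_divisor_def by blast
      then show ?thesis unfolding common_nonunit_divisor_def using assms
        by (intro bexI[of _ "(z, \<one>\<^bsub>B\<^esub>)"] bexI[of _ "(r, b)"] bexI[of _ "(s, b')"])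
          (auto simp: Units_RDirProd)
    next
      assume "common_nonunit_divisor B b b'"
      then obtain z r s where "z \<in> carrier B" "z \<notin> Units B" "r \<in> carrier B" "s \<in> carrier B"
        "b = r \<otimes>\<^bsub>B\<^esub> z" "b' = s \<otimes>\<^bsub>B\<^esub> z" unfolding common_nonunit_divisor_def by blast
      then show ?thesis unfolding common_nonunit_divisor_def using assms
        by (intro bexI[of _ "(\<one>\<^bsub>A\<^esub>, z)"] bexI[of _ "(a, r)"] bexI[of _ "(a', s)"])
          (auto simp: Units_RDirProd)
    qed
  qed
qed

section \<open>Splitting along an idempotent\<close>

text \<open>The Peirce corner \<open>eR\<close> with identity \<open>e\<close>. It keeps the element
  type and the operations of \<open>R\<close>, so calculations take place in
  \<open>R\<close>.\<close>

definition corner :: "('a, 'b) ring_scheme \<Rightarrow> 'a \<Rightarrow> ('a, 'b) ring_scheme"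
  where "corner R e = R\<lparr>carrier := {e \<otimes>\<^bsub>R\<^esub> x |x. x \<in> carrier R}, one := e\<rparr>"

context cring
begin

lemma corner_simps [simp]:
  "\<zero>\<^bsub>corner R e\<^esub> = \<zero>" "\<one>\<^bsub>corner R e\<^esub> = e"
  "x \<oplus>\<^bsub>corner R e\<^esub> y = x \<oplus> y" "x \<otimes>\<^bsub>corner R e\<^esub> y = x \<otimes> y"
  by (simp_all add: corner_def)

text \<open>Membership becomes the equation \<open>e \<otimes> x = x\<close>, which makes the
  closure properties equational.\<close>

lemma mem_corner_iff:
  assumes "e \<in> carrier R" "e \<otimes> e = e"
  shows "x \<in> carrier (corner R e) \<longleftrightarrow> x \<in> carrier R \<and> e \<otimes> x = x"
proof
  assume "x \<in> carrier (corner R e)"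
  then show "x \<in> carrier R \<and> e \<otimes> x = x"
    using assms by (auto simp: corner_def m_assoc[symmetric])
next
  assume "x \<in> carrier R \<and> e \<otimes> x = x"
  then show "x \<in> carrier (corner R e)" unfolding corner_def by auto metis
qed

lemma corner_cring:
  assumes e: "e \<in> carrier R" "e \<otimes> e = e"
  shows "cring (corner R e)"
proof (rule cringI)
  show "abelian_group (corner R e)"
  proof (rule abelian_groupI)
    fix x assume x: "x \<in> carrier (corner R e)"
    then have "\<ominus> x \<in> carrier (corner R e)" using e by (simp add: mem_corner_iff r_minus)
    then show "\<exists>y \<in> carrier (corner R e). y \<oplus>\<^bsub>corner R e\<^esub> x = \<zero>\<^bsub>corner R e\<^esub>"
      using x e by (intro bexI[of _ "\<ominus> x"]) (auto simp: mem_corner_iff l_neg)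
  qed (use e in \<open>auto simp: mem_corner_iff r_distr a_ac\<close>)
  show "comm_monoid (corner R e)"
  proof (rule comm_monoidI)
    fix x y assume "x \<in> carrier (corner R e)" "y \<in> carrier (corner R e)"
    then show "x \<otimes>\<^bsub>corner R e\<^esub> y \<in> carrier (corner R e)"
      using e by (simp add: mem_corner_iff m_assoc[symmetric])
  qed (use e in \<open>auto simp: mem_corner_iff m_ac\<close>)
qed (use e in \<open>auto simp: mem_corner_iff l_distr\<close>)

text \<open>The Peirce decomposition: \<open>e\<close> and \<open>f = 1 - e\<close> are orthogonal
  idempotents with sum 1, and adding the components inverts the map.\<close>

lemma ring_iso_corners:
  assumes e: "e \<in> carrier R" "e \<otimes> e = e"
  shows "(\<lambda>x. (e \<otimes> x, (\<one> \<ominus> e) \<otimes> x)) \<in> ring_iso R (RDirProd (corner R e) (corner R (\<one> \<ominus> e)))"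
    and "(\<one> \<ominus> e) \<otimes> (\<one> \<ominus> e) = \<one> \<ominus> e"
proof -
  define f where "f = \<one> \<ominus> e"
  have f: "f \<in> carrier R" using e by (simp add: f_def)
  have ef: "e \<otimes> f = \<zero>" using e unfolding f_def by (simp add: a_minus_def r_distr r_minus r_neg)
  have sum: "e \<oplus> f = \<one>" using e unfolding f_def by algebra
  have ff: "f \<otimes> f = f"
  proof -
    have "f \<otimes> f = (e \<oplus> f) \<otimes> f" using e f ef by (simp add: l_distr)
    then show ?thesis using sum f by simp
  qed
  then show "(\<one> \<ominus> e) \<otimes> (\<one> \<ominus> e) = \<one> \<ominus> e" unfolding f_def .
  have decomp: "x = e \<otimes> x \<oplus> f \<otimes> x" if "x \<in> carrier R" for x
    using that e f sum by (metis l_distr l_one)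
  have idem: "g \<otimes> (x \<otimes> y) = (g \<otimes> x) \<otimes> (g \<otimes> y)"
    if "g \<in> carrier R" "g \<otimes> g = g" "x \<in> carrier R" "y \<in> carrier R" for g x y
  proof -
    have "(g \<otimes> x) \<otimes> (g \<otimes> y) = (g \<otimes> g) \<otimes> (x \<otimes> y)" using that(1,3,4) by algebra
    then show ?thesis using that(2) by simp
  qed
  have "bij_betw (\<lambda>x. (e \<otimes> x, f \<otimes> x)) (carrier R) (carrier (RDirProd (corner R e) (corner R f)))"
  proof (rule bij_betw_byWitness[where f' = "\<lambda>(x, y). x \<oplus> y"])
    show "\<forall>x \<in> carrier R. (\<lambda>(x, y). x \<oplus> y) (e \<otimes> x, f \<otimes> x) = x" using decomp by simp
    have "e \<otimes> (x \<oplus> y) = x \<and> f \<otimes> (x \<oplus> y) = y"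
      if "x \<in> carrier R" "y \<in> carrier R" and xy: "e \<otimes> x = x" "f \<otimes> y = y" for x y
    proof -
      \<comment> \<open>Substituting \<open>y = f \<otimes> y\<close> and
        \<open>x = e \<otimes> x\<close> exposes the factor \<open>e \<otimes> f\<close>, which is
        zero.\<close>
      have "e \<otimes> y = (e \<otimes> f) \<otimes> y" "f \<otimes> x = (e \<otimes> f) \<otimes> x"
        using that e f by (simp_all add: m_assoc) (simp add: m_lcomm[of e f x])
      then have "e \<otimes> y = \<zero>" "f \<otimes> x = \<zero>" using ef that by simp_all
      then show ?thesis using that e f by (simp add: r_distr)
    qed
    then show "\<forall>x \<in> carrier (RDirProd (corner R e) (corner R f)).
        (e \<otimes> (case x of (x, y) \<Rightarrow> x \<oplus> y), f \<otimes> (case x of (x, y) \<Rightarrow> x \<oplus> y)) = x"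
      using e f ff by (auto simp: mem_corner_iff)
    show "(\<lambda>x. (e \<otimes> x, f \<otimes> x)) ` carrier R \<subseteq> carrier (RDirProd (corner R e) (corner R f))"
      using e f ff by (auto simp: mem_corner_iff m_assoc[symmetric])
    show "(\<lambda>(x, y). x \<oplus> y) ` carrier (RDirProd (corner R e) (corner R f)) \<subseteq> carrier R"
      using e f ff by (auto simp: mem_corner_iff)
  qed
  then have "(\<lambda>x. (e \<otimes> x, f \<otimes> x)) \<in> ring_iso R (RDirProd (corner R e) (corner R f))"
    by (intro ring_iso_memI) (use e f ff in \<open>auto simp: bij_betw_def idem r_distr\<close>)
  then show "(\<lambda>x. (e \<otimes> x, (\<one> \<ominus> e) \<otimes> x)) \<in>
      ring_iso R (RDirProd (corner R e) (corner R (\<one> \<ominus> e)))"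
    unfolding f_def .
qed

lemma idempotent_imp_RDirProd:
  assumes e: "e \<in> carrier R" "e \<otimes> e = e" "e \<noteq> \<zero>" "e \<noteq> \<one>"
  obtains A B :: "('a, 'b) ring_scheme"
    where "cring A" "cring B" "\<one>\<^bsub>A\<^esub> \<noteq> \<zero>\<^bsub>A\<^esub>" "\<one>\<^bsub>B\<^esub> \<noteq> \<zero>\<^bsub>B\<^esub>" "R \<simeq> RDirProd A B"
proof
  have f: "\<one> \<ominus> e \<in> carrier R" using e by simp
  show "cring (corner R e)" "cring (corner R (\<one> \<ominus> e))"
    using corner_cring e f ring_iso_corners(2) by auto
  show "\<one>\<^bsub>corner R e\<^esub> \<noteq> \<zero>\<^bsub>corner R e\<^esub>" using e by simp
  have "\<one> \<ominus> e \<noteq> \<zero>" using e by auto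
  then show "\<one>\<^bsub>corner R (\<one> \<ominus> e)\<^esub> \<noteq> \<zero>\<^bsub>corner R (\<one> \<ominus> e)\<^esub>" by simp
  show "R \<simeq> RDirProd (corner R e) (corner R (\<one> \<ominus> e))"
    using ring_iso_corners(1)[OF e(1,2)] unfolding is_ring_iso_def by blast
qed

end

section \<open>Consequences of claw-freeness\<close>

text \<open>The source of all finiteness in the classification: an infinite set would contain a
  subset of size 3.\<close>

lemma no_card_3_subset:
  assumes "\<And>T. T \<subseteq> S \<Longrightarrow> card T \<noteq> 3"
  shows "finite S" "card S \<le> 2"
proof -
  show fin: "finite S" using assms infinite_arbitrarily_large[of S 3] by blast
  show "card S \<le> 2"
  proof (rule ccontr)
    assume "\<not> card S \<le> 2"
    then obtain T where "T \<subseteq> S" "card T = 3"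
      using obtain_subset_with_card_n[of 3 S] by (metis Suc_leI eval_nat_numeral(3) not_less)
    then show False using assms by blast
  qed
qed

lemma (in cring) PIdl_nonunit:
  assumes "m \<in> carrier R - Units R" "x \<in> PIdl m"
  shows "x \<in> carrier R - Units R"
  using assms unit_factor[of m] m_comm unfolding cgenideal_def by auto

text \<open>The claw has centre \<open>(0, 1)\<close>; its leaves are multiples of \<open>(1, m)\<close> that are comaximal
  with the centre.\<close>
lemma claw_free_RDirProd:
  assumes "cring A" "cring B" and "\<one>\<^bsub>A\<^esub> \<noteq> \<zero>\<^bsub>A\<^esub>" and cf: "claw_free (RDirProd A B)"
    and m: "m \<in> carrier B - Units B"
  shows "finite (Units A)" "finite (PIdl\<^bsub>B\<^esub> m)" "card (Units A) * card (PIdl\<^bsub>B\<^esub> m) \<le> 2"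
proof -
  interpret A: cring A by fact
  interpret B: cring B by fact
  let ?S = "Units A \<times> (PIdl\<^bsub>B\<^esub> m)"
  have zero: "\<zero>\<^bsub>A\<^esub> \<notin> Units A"
    using assms(3) unfolding Units_def by auto
  have no: "card T \<noteq> 3" if T: "T \<subseteq> ?S" for T
  proof
    assume "card T = 3"
    moreover have "T \<subseteq> carrier (RDirProd A B) - Units (RDirProd A B)"
      using T B.PIdl_nonunit[OF m] by (auto simp: Units_RDirProd)
    moreover have "common_nonunit_divisor (RDirProd A B) x y" if xT: "x \<in> T" and yT: "y \<in> T" for x y
    proof -
      obtain u b v c where xy: "x = (u, b)" "y = (v, c)" "u \<in> Units A" "v \<in> Units A"
        "b \<in> PIdl\<^bsub>B\<^esub> m" "c \<in> PIdl\<^bsub>B\<^esub> m"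
        using subsetD[OF T xT] subsetD[OF T yT] by (elim SigmaE)
      then have "common_nonunit_divisor B b c"
        using m unfolding common_nonunit_divisor_def cgenideal_def by blast
      then show ?thesis
        using xy B.PIdl_nonunit[OF m] RDirProd_common_nonunit_divisor[OF assms(1,2)]
          A.Units_closed by auto
    qed
    moreover have "\<not> common_nonunit_divisor (RDirProd A B) (\<zero>\<^bsub>A\<^esub>, \<one>\<^bsub>B\<^esub>) x" if xT: "x \<in> T" for x
    proof -
      obtain u b where x: "x = (u, b)" "u \<in> Units A" "b \<in> PIdl\<^bsub>B\<^esub> m"
        using subsetD[OF T xT] by (elim SigmaE)
      then show ?thesis
        using B.PIdl_nonunit[OF m] RDirProd_common_nonunit_divisor[OF assms(1,2)]
          A.not_common_nonunit_divisor_unit B.not_common_nonunit_divisor_unit A.Units_closed by auto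
    qed
    moreover have "(\<zero>\<^bsub>A\<^esub>, \<one>\<^bsub>B\<^esub>) \<in> carrier (RDirProd A B) - Units (RDirProd A B)"
      using zero by (simp add: Units_RDirProd)
    ultimately show False using cf unfolding claw_free_def by blast
  qed
  \<comment> \<open>Finiteness of a product set passes to one factor only if the other is
    nonempty.\<close>
  have ne: "\<one>\<^bsub>A\<^esub> \<in> Units A" "m \<in> PIdl\<^bsub>B\<^esub> m" using m B.cgenideal_self by auto
  have "finite ?S" by (rule no_card_3_subset(1)[OF no])
  then show "finite (Units A)" "finite (PIdl\<^bsub>B\<^esub> m)"
    using ne finite_cartesian_productD1 finite_cartesian_productD2 by blast+
  show "card (Units A) * card (PIdl\<^bsub>B\<^esub> m) \<le> 2"
    using no_card_3_subset(2)[of ?S] no by (simp add: card_cartesian_product)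
qed

section \<open>From a non-local ring to an idempotent\<close>

context cring
begin

text \<open>Contrapositive: if \<open>1 - x\<close> is a unit for every non-unit \<open>x\<close>,
  the non-units form an ideal, which is then the only maximal one.\<close>

lemma not_local_imp_comaximal_nonunits:
  assumes "\<one> \<noteq> \<zero>" "\<not> is_local_ring R"
  obtains x where "x \<in> carrier R - Units R" "\<one> \<ominus> x \<in> carrier R - Units R"
proof -
  let ?N = "carrier R - Units R"
  have "\<exists>x. x \<in> ?N \<and> \<one> \<ominus> x \<in> ?N"
  proof (rule ccontr)
    assume "\<nexists>x. x \<in> ?N \<and> \<one> \<ominus> x \<in> ?N"
    then have comax: "\<And>x. x \<in> ?N \<Longrightarrow> \<one> \<ominus> x \<in> Units R" by (metis DiffD1 DiffI minus_closed one_closed)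
    have zero: "\<zero> \<in> ?N" using assms(1) by (auto simp: Units_def)
    have mult: "r \<otimes> x \<in> ?N" if "x \<in> ?N" "r \<in> carrier R" for x r
      using that unit_factor[of x r] m_comm[of r x] by auto
    have add: "x \<oplus> y \<in> ?N" if "x \<in> ?N" "y \<in> ?N" for x y
    proof (rule ccontr)
      assume "x \<oplus> y \<notin> ?N"
      then have u: "x \<oplus> y \<in> Units R" using that by auto
      \<comment> \<open>Scaling by the inverse turns the sum into 1, so that
        \<open>?v \<otimes> x\<close> and \<open>?v \<otimes> y = 1 - ?v \<otimes> x\<close> are
        both non-units.\<close>
      let ?v = "inv (x \<oplus> y)"
      have v: "?v \<in> carrier R" "?v \<otimes> (x \<oplus> y) = \<one>" using u by auto
      have xy: "x \<in> carrier R" "y \<in> carrier R" using that by auto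
      have "\<one> \<ominus> ?v \<otimes> x = ?v \<otimes> (x \<oplus> y) \<ominus> ?v \<otimes> x" using v(2) by simp
      also have "\<dots> = ?v \<otimes> y" using v(1) xy by algebra
      finally have "\<one> \<ominus> ?v \<otimes> x = ?v \<otimes> y" .
      then show False using comax[OF mult[OF that(1) v(1)]] mult[OF that(2) v(1)] by simp
    qed
    have ideal: "ideal ?N R"
    proof (rule idealI)
      show "subgroup ?N (add_monoid R)"
      proof (rule add.subgroupI)
        show "?N \<noteq> {}" using zero by blast
        fix x assume x: "x \<in> ?N"
        then have "\<ominus> x = (\<ominus> \<one>) \<otimes> x" using l_minus[of \<one> x] by simp
        then show "\<ominus> x \<in> ?N" using mult[OF x, of "\<ominus> \<one>"] by simp
      qed (use add in auto)
    qed (use mult m_comm in \<open>auto simp: ring_axioms\<close>)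
    \<comment> \<open>A proper ideal contains no unit; this gives both maximality and uniqueness of
      \<open>?N\<close>.\<close>
    have sub: "J \<subseteq> ?N" if "ideal J R" "J \<noteq> carrier R" for J
    proof
      interpret J: ideal J R by fact
      fix x assume x: "x \<in> J"
      have "x \<notin> Units R"
      proof
        assume "x \<in> Units R"
        then have "\<one> = inv x \<otimes> x" "inv x \<in> carrier R" by auto
        then have "\<one> \<in> J" using J.I_l_closed[OF x] by metis
        then show False using J.one_imp_carrier that(2) by blast
      qed
      then show "x \<in> ?N" using x J.Icarr by blast
    qed
    have "maximalideal ?N R"
    proof (rule maximalidealI[OF ideal])
      show "carrier R \<noteq> ?N" using one_closed Units_one_closed by blast
      show "J = ?N \<or> J = carrier R" if "ideal J R" "?N \<subseteq> J" "J \<subseteq> carrier R" for J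
        using sub[OF that(1)] that by blast
    qed
    moreover have "M = ?N" if "maximalideal M R" for M
    proof -
      interpret M: maximalideal M R by fact
      have "M \<subseteq> ?N" using sub M.ideal_axioms M.I_notcarr by metis
      then show ?thesis using M.I_maximal[OF ideal] M.I_notcarr one_closed Units_one_closed by blast
    qed
    ultimately have "is_local_ring R" unfolding is_local_ring_def by blast
    then show False using assms(2) by blast
  qed
  then show ?thesis using that by blast
qed

text \<open>Unless two of \<open>x\<close>, \<open>x\<^sup>2\<close>, \<open>x\<^sup>3\<close> coincide, they are the leaves of a claw with centre
  \<open>1 - x\<close>; hence \<open>x\<^sup>4 = x\<^sup>2\<close>.\<close>
lemma claw_free_imp_idempotent:
  assumes cf: "claw_free R" and x: "x \<in> carrier R - Units R" and y: "\<one> \<ominus> x \<in> carrier R - Units R"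
  obtains e where "e \<in> carrier R" "e \<otimes> e = e" "e \<noteq> \<zero>" "e \<noteq> \<one>"
proof
  let ?e = "x \<otimes> x" and ?c = "x \<otimes> x \<otimes> x"
  have xc: "x \<in> carrier R" using x by blast
  show e: "?e \<in> carrier R" using xc by simp
  have unit: "b \<in> Units R" if "b \<in> carrier R" "c \<in> carrier R" "c \<otimes> b = \<one>" for b c
    using that m_comm[of b c] unfolding Units_def by auto
  show "?e \<noteq> \<one>" using x unit[OF xc xc] by auto
  show "?e \<noteq> \<zero>"
  proof
    assume "?e = \<zero>"
    moreover have "(\<one> \<oplus> x) \<otimes> (\<one> \<ominus> x) = \<one> \<ominus> ?e" using xc by algebra
    ultimately have "(\<one> \<oplus> x) \<otimes> (\<one> \<ominus> x) = \<one>" by (simp add: minus_eq)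
    then show False using unit[of "\<one> \<ominus> x" "\<one> \<oplus> x"] xc y by simp
  qed
  have mults: "\<exists>r \<in> carrier R. w = r \<otimes> x" if "w \<in> {x, ?e, ?c}" for w
    using that xc by (auto intro: bexI[of _ \<one>])
  \<comment> \<open>The cofactors \<open>p\<close> are the partial geometric sums 1,
    \<open>1 + x\<close> and \<open>1 + x + x^2\<close>; \<open>q\<close> is 1.\<close>
  have comax: "\<exists>p \<in> carrier R. \<exists>q \<in> carrier R. p \<otimes> (\<one> \<ominus> x) \<oplus> q \<otimes> w = \<one>" if "w \<in> {x, ?e, ?c}" for w
  proof -
    have "\<one> \<otimes> (\<one> \<ominus> x) \<oplus> \<one> \<otimes> x = \<one>" "(\<one> \<oplus> x) \<otimes> (\<one> \<ominus> x) \<oplus> \<one> \<otimes> ?e = \<one>"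
      "(\<one> \<oplus> x \<oplus> ?e) \<otimes> (\<one> \<ominus> x) \<oplus> \<one> \<otimes> ?c = \<one>" using xc by algebra+
    then show ?thesis using that xc by (metis a_closed e insertE one_closed singletonD)
  qed
  have "card {x, ?e, ?c} \<noteq> 3"
  proof
    assume "card {x, ?e, ?c} = 3"
    moreover have "w \<in> carrier R - Units R" if w: "w \<in> {x, ?e, ?c}" for w
    proof -
      obtain r where "r \<in> carrier R" "w = r \<otimes> x" using mults[OF w] by blast
      then show ?thesis using x unit_factor[of x r] m_comm[of r x] by auto
    qed
    moreover have "common_nonunit_divisor R w w'" if "w \<in> {x, ?e, ?c}" "w' \<in> {x, ?e, ?c}" for w w'
      using mults[OF that(1)] mults[OF that(2)] x unfolding common_nonunit_divisor_def by blast
    moreover have "\<not> common_nonunit_divisor R (\<one> \<ominus> x) w" if w: "w \<in> {x, ?e, ?c}" for w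
    proof
      assume "common_nonunit_divisor R (\<one> \<ominus> x) w"
      then obtain z r s where z: "z \<in> carrier R" "z \<notin> Units R" "r \<in> carrier R" "s \<in> carrier R"
        "\<one> \<ominus> x = r \<otimes> z" "w = s \<otimes> z" unfolding common_nonunit_divisor_def by blast
      obtain p q where pq: "p \<in> carrier R" "q \<in> carrier R" "p \<otimes> (\<one> \<ominus> x) \<oplus> q \<otimes> w = \<one>"
        using comax[OF w] by blast
      then have "(p \<otimes> r \<oplus> q \<otimes> s) \<otimes> z = \<one>" using z by (simp add: l_distr m_assoc)
      moreover have "p \<otimes> r \<oplus> q \<otimes> s \<in> carrier R" using z pq by simp
      ultimately show False using unit[OF z(1)] z(2) by blast
    qed
    ultimately have "\<not> claw_free R"
      unfolding claw_free_def not_not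
      by (intro bexI[OF _ y] exI[of _ "{x, ?e, ?c}"] conjI) blast+
    then show False using cf by simp
  qed
  \<comment> \<open>Multiplying each coincidence by suitable powers of \<open>x\<close> gives
    \<open>x^4 = x^2\<close>.\<close>
  then consider "x = ?e" | "x = ?c" | "?e = ?c" by (auto simp: card_insert_if split: if_splits)
  then show "?e \<otimes> ?e = ?e" using xc by cases (simp_all add: m_assoc)
qed

end

section \<open>Rings with at most four elements\<close>

lemma residue_ring_cring: "1 < k \<Longrightarrow> cring (residue_ring k)"
  using residues.cring[of k] by (simp add: residues_def)

section \<open>Recognising residue rings\<close>

context cring
begin

text \<open>The canonical map from the integers, \<open>i\<close> to \<open>i\<close> times 1, is
  multiplicative by itself and factors modulo \<open>k\<close> by \<open>zero\<close>. Injectivity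
  on the representatives follows by counting. So the additive behaviour of 1 is all that has to be
  checked.\<close>

lemma iso_residue_ringI:
  fixes k :: int
  assumes k: "1 < k" and zero: "add_pow R k \<one> = \<zero>"
    and gen: "carrier R = (\<lambda>i::int. add_pow R i \<one>) ` {0..k - 1}" and card: "card (carrier R) = nat k"
  shows "R \<simeq> residue_ring k"
proof -
  let ?g = "\<lambda>i::int. add_pow R i \<one>"
  have add: "?g (i + j) = ?g i \<oplus> ?g j" for i j
    by (simp add: add.int_pow_mult)
  have mod: "?g (i mod k) = ?g i" for i
  proof -
    have "?g (k * (i div k)) = \<zero>"
      using add.int_pow_pow[of \<one> "i div k" k] zero add.int_pow_one[of "i div k"]
      by (simp add: mult.commute)
    then show ?thesis using add[of "k * (i div k)" "i mod k"] by simp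
  qed
  have mult: "?g (i * j) = ?g i \<otimes> ?g j" for i j
  proof -
    have "?g i \<otimes> ?g j = add_pow R i (?g j)" by (simp add: add_pow_ldistr_int)
    then show ?thesis using add.int_pow_pow[of \<one> i j] by (simp add: mult.commute)
  qed
  have "bij_betw ?g (carrier (residue_ring k)) (carrier R)"
    unfolding bij_betw_def
    using gen card k by (simp add: residue_ring_def eq_card_imp_inj_on)
  then have "?g \<in> ring_iso (residue_ring k) R"
    by (intro ring_iso_memI) (auto simp: residue_ring_def mod add mult)
  then show ?thesis
    using residue_ring_cring[OF k] ring_iso_set_sym
    unfolding is_ring_iso_def cring_def by blast
qed

lemma add_pow_one_numerals:
  "add_pow R (0::int) \<one> = \<zero>" "add_pow R (2::int) \<one> = \<one> \<oplus> \<one>" "add_pow R (3::int) \<one> = \<one> \<oplus> \<one> \<oplus> \<one>"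
  "add_pow R (4::int) \<one> = \<one> \<oplus> \<one> \<oplus> \<one> \<oplus> \<one>"
proof -
  have "add_pow R (i + 1 :: int) \<one> = add_pow R i \<one> \<oplus> \<one>" for i
    by (simp add: add.int_pow_mult)
  from add.int_pow_1[of \<one>] this[of 1] this[of 2] this[of 3] show "add_pow R (2::int) \<one> = \<one> \<oplus> \<one>"
    "add_pow R (3::int) \<one> = \<one> \<oplus> \<one> \<oplus> \<one>" "add_pow R (4::int) \<one> = \<one> \<oplus> \<one> \<oplus> \<one> \<oplus> \<one>"
    by simp_all
  show "add_pow R (0::int) \<one> = \<zero>" using int_pow_0[of "add_monoid R" \<one>] by (simp add: add_pow_def)
qed

lemma add_self_cancel:
  assumes "x \<in> carrier R" "y \<in> carrier R" "x \<oplus> y = x"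
  shows "y = \<zero>"
  using assms add.r_cancel_one'[of x y] by auto

lemma iso_residue_ring_2:
  assumes "carrier R = {\<zero>, \<one>}" "\<one> \<noteq> \<zero>"
  shows "R \<simeq> residue_ring 2"
proof (rule iso_residue_ringI)
  have "\<one> \<oplus> \<one> \<in> {\<zero>, \<one>}" using assms(1) by blast
  then show "add_pow R (2::int) \<one> = \<zero>"
    using add_self_cancel[of \<one> \<one>] assms(2) by (auto simp: add_pow_one_numerals)
  have "{0..2 - 1::int} = {0, 1}" by auto
  then show "carrier R = (\<lambda>i::int. add_pow R i \<one>) ` {0..2 - 1}" using assms(1) add_pow_one_numerals(1) add.int_pow_1[of \<one>] by simp
  show "card (carrier R) = nat 2" using assms by simp
qed simp

text \<open>Cancellation forces the additive table: \<open>1 + u\<close> can only be 0, and then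
  \<open>1 + 1\<close> can only be \<open>u\<close>.\<close>

lemma iso_residue_ring_3:
  assumes "carrier R = {\<zero>, \<one>, u}" "\<one> \<noteq> \<zero>" "u \<noteq> \<zero>" "u \<noteq> \<one>"
  shows "R \<simeq> residue_ring 3"
proof (rule iso_residue_ringI)
  have u: "u \<in> carrier R" using assms(1) by blast
  have "\<one> \<oplus> u \<in> {\<zero>, \<one>, u}" using assms(1) u by blast
  then have 1: "\<one> \<oplus> u = \<zero>"
  proof (elim insertE emptyE)
    assume "\<one> \<oplus> u = \<one>" then show ?thesis using add_self_cancel[of \<one> u] u assms(3) by blast
  next
    assume "\<one> \<oplus> u = u" then show ?thesis
      using add_self_cancel[of u \<one>] a_comm[of \<one> u] u assms(2) by auto
  qed
  have "\<one> \<oplus> \<one> \<noteq> \<zero>"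
  proof
    assume "\<one> \<oplus> \<one> = \<zero>"
    then have "u = \<one>" using 1 u add.l_cancel[of \<one> u \<one>] by simp
    then show False using assms(4) by blast
  qed
  moreover have "\<one> \<oplus> \<one> \<in> {\<zero>, \<one>, u}" using assms(1) by blast
  ultimately have 2: "\<one> \<oplus> \<one> = u" using add_self_cancel[of \<one> \<one>] assms(2) by auto
  show "add_pow R (3::int) \<one> = \<zero>" using 1 2 u a_comm[of \<one> u] by (simp add: add_pow_one_numerals)
  have "{0..3 - 1::int} = {0, 1, 2}" by auto
  then show "carrier R = (\<lambda>i::int. add_pow R i \<one>) ` {0..3 - 1}"
    using assms(1) 2 add_pow_one_numerals(1) add.int_pow_1[of \<one>]
    by (auto simp: add_pow_one_numerals)
  show "card (carrier R) = nat 3" using assms by simp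
qed simp

text \<open>\<open>n + n\<close> is \<open>(1 + 1) n\<close>, hence 0 or \<open>n^2\<close>. The
  alternative covers both local rings of four elements that have a nonzero nilpotent.\<close>

lemma two_n_eq_zero:
  assumes "n \<in> carrier R" "n \<otimes> n = \<zero>" "\<one> \<oplus> \<one> = \<zero> \<or> \<one> \<oplus> \<one> = n"
  shows "n \<oplus> n = \<zero>"
proof -
  have "n \<oplus> n = (\<one> \<oplus> \<one>) \<otimes> n" using assms(1) by (simp add: l_distr)
  then show ?thesis using assms by auto
qed

text \<open>Only \<open>1 + n \<noteq> 0\<close> uses more than cancellation and
  \<open>1 \<noteq> 0\<close> in a visible way: \<open>(1 + n) n = n\<close> because
  \<open>n^2 = 0\<close>.\<close>

lemma four_elements_distinct:
  assumes "n \<in> carrier R" "n \<noteq> \<zero>" "n \<otimes> n = \<zero>"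
  shows "\<one> \<noteq> \<zero>" "n \<noteq> \<one>" "\<one> \<oplus> n \<noteq> \<zero>" "\<one> \<oplus> n \<noteq> \<one>" "\<one> \<oplus> n \<noteq> n"
proof -
  show 1: "\<one> \<noteq> \<zero>" using assms(1,2) l_one l_null by metis
  show "n \<noteq> \<one>" using 1 assms(3) by auto
  show "\<one> \<oplus> n \<noteq> \<zero>"
  proof
    assume *: "\<one> \<oplus> n = \<zero>"
    have "n = (\<one> \<oplus> n) \<otimes> n" using assms(1,3) by (simp add: l_distr)
    then show False using * assms(1,2) by simp
  qed
  show "\<one> \<oplus> n \<noteq> \<one>" using assms add_self_cancel[of \<one> n] by auto
  show "\<one> \<oplus> n \<noteq> n" using assms(1) 1 add_self_cancel[of n \<one>] a_comm[of n \<one>] by auto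
qed

text \<open>Here \<open>n\<close> plays the residue 2 and \<open>1 + n\<close> the residue
  3.\<close>

lemma iso_residue_ring_4:
  assumes n: "n \<in> carrier R" "n \<noteq> \<zero>" "n \<otimes> n = \<zero>" "\<one> \<oplus> \<one> = n"
    and carrier: "carrier R = {\<zero>, \<one>, n, \<one> \<oplus> n}"
  shows "R \<simeq> residue_ring 4"
proof (rule iso_residue_ringI)
  note nn = two_n_eq_zero[OF n(1,3) disjI2[OF n(4)]] and d = four_elements_distinct[OF n(1-3)]
  have three: "n \<oplus> \<one> = \<one> \<oplus> n" using n(1) by (simp add: a_comm)
  have "\<one> \<oplus> \<one> \<oplus> \<one> \<oplus> \<one> = (\<one> \<oplus> \<one>) \<oplus> (\<one> \<oplus> \<one>)" by (simp add: a_assoc)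
  then show "add_pow R (4::int) \<one> = \<zero>" using nn n(4) by (simp add: add_pow_one_numerals)
  have "{0..4 - 1::int} = {0, 1, 2, 3}" by auto
  then have "(\<lambda>i::int. add_pow R i \<one>) ` {0..4 - 1} = {\<zero>, \<one>, n, \<one> \<oplus> n}"
    by (simp only: image_insert image_empty add_pow_one_numerals three n(4)
      add_pow_one_numerals add.int_pow_1[OF one_closed])
  then show "carrier R = (\<lambda>i::int. add_pow R i \<one>) ` {0..4 - 1}" using carrier by simp
  show "card (carrier R) = nat 4" unfolding carrier using n(2) d by simp
qed simp

end

section \<open>Dual numbers over the field with two elements\<close>

text \<open>An intrinsic description of the quotient by \<open>X^2\<close>, with \<open>n\<close> as
  the class of \<open>X\<close>. Polynomials then enter only once, in showing that the quotient fits
  it.\<close>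

definition dual_numbers :: "('a, 'b) ring_scheme \<Rightarrow> 'a \<Rightarrow> bool"
  where "dual_numbers R n \<longleftrightarrow> cring R \<and> n \<in> carrier R \<and> n \<noteq> \<zero>\<^bsub>R\<^esub> \<and> n \<otimes>\<^bsub>R\<^esub> n = \<zero>\<^bsub>R\<^esub> \<and>
    \<one>\<^bsub>R\<^esub> \<oplus>\<^bsub>R\<^esub> \<one>\<^bsub>R\<^esub> = \<zero>\<^bsub>R\<^esub> \<and> carrier R = {\<zero>\<^bsub>R\<^esub>, \<one>\<^bsub>R\<^esub>, n, \<one>\<^bsub>R\<^esub> \<oplus>\<^bsub>R\<^esub> n}"

lemma dual_numbers_tables:
  fixes R (structure)
  assumes "dual_numbers R n"
  shows "n \<otimes> n = \<zero>" "\<one> \<oplus> \<one> = \<zero>" "n \<oplus> n = \<zero>" "n \<oplus> \<one> = \<one> \<oplus> n"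
    "\<one> \<oplus> (\<one> \<oplus> n) = n" "(\<one> \<oplus> n) \<oplus> \<one> = n" "n \<oplus> (\<one> \<oplus> n) = \<one>" "(\<one> \<oplus> n) \<oplus> n = \<one>"
    "(\<one> \<oplus> n) \<oplus> (\<one> \<oplus> n) = \<zero>"
    "n \<otimes> (\<one> \<oplus> n) = n" "(\<one> \<oplus> n) \<otimes> n = n" "(\<one> \<oplus> n) \<otimes> (\<one> \<oplus> n) = \<one>"
proof -
  interpret cring R using assms unfolding dual_numbers_def by blast
  have n: "n \<in> carrier R" and n2: "n \<otimes> n = \<zero>" and two: "\<one> \<oplus> \<one> = \<zero>"
    using assms unfolding dual_numbers_def by blast+
  note nn = two_n_eq_zero[OF n n2 disjI1[OF two]]
  show "n \<otimes> n = \<zero>" "\<one> \<oplus> \<one> = \<zero>" "n \<oplus> n = \<zero>" by fact+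
  show "n \<oplus> \<one> = \<one> \<oplus> n" using n by (simp add: a_comm)
  show 1: "\<one> \<oplus> (\<one> \<oplus> n) = n" using n two by (simp add: a_assoc[symmetric])
  show "(\<one> \<oplus> n) \<oplus> \<one> = n" using 1 n by (simp add: a_comm)
  show 2: "(\<one> \<oplus> n) \<oplus> n = \<one>" using n nn by (simp add: a_assoc)
  show "n \<oplus> (\<one> \<oplus> n) = \<one>" using 2 n by (simp add: a_comm)
  show "(\<one> \<oplus> n) \<oplus> (\<one> \<oplus> n) = \<zero>"
  proof -
    have "(\<one> \<oplus> n) \<oplus> (\<one> \<oplus> n) = (\<one> \<oplus> \<one>) \<oplus> (n \<oplus> n)" using n by algebra
    then show ?thesis using two nn by simp
  qed
  show "n \<otimes> (\<one> \<oplus> n) = n" "(\<one> \<oplus> n) \<otimes> n = n" using n n2 by (simp_all add: r_distr l_distr)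
  show "(\<one> \<oplus> n) \<otimes> (\<one> \<oplus> n) = \<one>"
  proof -
    have "(\<one> \<oplus> n) \<otimes> (\<one> \<oplus> n) = \<one> \<oplus> (n \<oplus> n) \<oplus> n \<otimes> n" using n by algebra
    then show ?thesis using nn n2 by simp
  qed
qed

text \<open>The defining conditions determine both operation tables, so sending \<open>n\<close> to
  \<open>m\<close> leaves a finite check.\<close>

lemma dual_numbers_iso:
  assumes R: "dual_numbers R n" and S: "dual_numbers S m"
  shows "R \<simeq> S"
proof -
  define h where "h x = (if x = \<zero>\<^bsub>R\<^esub> then \<zero>\<^bsub>S\<^esub> else if x = \<one>\<^bsub>R\<^esub> then \<one>\<^bsub>S\<^esub> else if x = n then m
    else \<one>\<^bsub>S\<^esub> \<oplus>\<^bsub>S\<^esub> m)" for x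
  have cR: "carrier R = {\<zero>\<^bsub>R\<^esub>, \<one>\<^bsub>R\<^esub>, n, \<one>\<^bsub>R\<^esub> \<oplus>\<^bsub>R\<^esub> n}" and cS: "carrier S = {\<zero>\<^bsub>S\<^esub>, \<one>\<^bsub>S\<^esub>, m, \<one>\<^bsub>S\<^esub> \<oplus>\<^bsub>S\<^esub> m}"
    and neR: "n \<noteq> \<zero>\<^bsub>R\<^esub>" and neS: "m \<noteq> \<zero>\<^bsub>S\<^esub>"
    using R S unfolding dual_numbers_def by blast+
  have dR: "\<one>\<^bsub>R\<^esub> \<noteq> \<zero>\<^bsub>R\<^esub>" "n \<noteq> \<one>\<^bsub>R\<^esub>" "\<one>\<^bsub>R\<^esub> \<oplus>\<^bsub>R\<^esub> n \<noteq> \<zero>\<^bsub>R\<^esub>" "\<one>\<^bsub>R\<^esub> \<oplus>\<^bsub>R\<^esub> n \<noteq> \<one>\<^bsub>R\<^esub>" "\<one>\<^bsub>R\<^esub> \<oplus>\<^bsub>R\<^esub> n \<noteq> n"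
    using cring.four_elements_distinct[of R n] R unfolding dual_numbers_def by blast+
  have dS: "\<one>\<^bsub>S\<^esub> \<noteq> \<zero>\<^bsub>S\<^esub>" "m \<noteq> \<one>\<^bsub>S\<^esub>" "\<one>\<^bsub>S\<^esub> \<oplus>\<^bsub>S\<^esub> m \<noteq> \<zero>\<^bsub>S\<^esub>" "\<one>\<^bsub>S\<^esub> \<oplus>\<^bsub>S\<^esub> m \<noteq> \<one>\<^bsub>S\<^esub>" "\<one>\<^bsub>S\<^esub> \<oplus>\<^bsub>S\<^esub> m \<noteq> m"
    using cring.four_elements_distinct[of S m] S unfolding dual_numbers_def by blast+
  have h: "h \<zero>\<^bsub>R\<^esub> = \<zero>\<^bsub>S\<^esub>" "h \<one>\<^bsub>R\<^esub> = \<one>\<^bsub>S\<^esub>" "h n = m" "h (\<one>\<^bsub>R\<^esub> \<oplus>\<^bsub>R\<^esub> n) = \<one>\<^bsub>S\<^esub> \<oplus>\<^bsub>S\<^esub> m"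
    using neR dR unfolding h_def by simp_all
  interpret R: cring R using R unfolding dual_numbers_def by blast
  interpret S: cring S using S unfolding dual_numbers_def by blast
  have carr: "n \<in> carrier R" "m \<in> carrier S" using cR cS by blast+
  note tR = dual_numbers_tables[OF R] and tS = dual_numbers_tables[OF S]
  have "inj_on h (carrier R)"
    unfolding cR using neS dS by (simp add: inj_on_def h)
  moreover have "h ` carrier R = carrier S" unfolding cR cS by (simp add: h)
  ultimately have bij: "bij_betw h (carrier R) (carrier S)" unfolding bij_betw_def by blast
  have "h \<in> ring_iso R S"
  proof (rule ring_iso_memI)
    show "h (x \<otimes>\<^bsub>R\<^esub> y) = h x \<otimes>\<^bsub>S\<^esub> h y" if "x \<in> carrier R" "y \<in> carrier R" for x y
      using that unfolding cR by (elim insertE emptyE) (simp_all add: h tR tS carr)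
    show "h (x \<oplus>\<^bsub>R\<^esub> y) = h x \<oplus>\<^bsub>S\<^esub> h y" if "x \<in> carrier R" "y \<in> carrier R" for x y
      using that unfolding cR by (elim insertE emptyE) (simp_all add: h tR tS carr)
    show "h x \<in> carrier S" if "x \<in> carrier R" for x
      using that bij unfolding bij_betw_def by blast
  qed (use h bij in simp_all)
  then show ?thesis unfolding is_ring_iso_def by blast
qed

text \<open>The witness is the class of \<open>X\<close>. Division with remainder by
  \<open>X^2\<close> leaves at most four classes, and a degree comparison shows that
  \<open>X\<close> is not a multiple of \<open>X^2\<close>.\<close>

lemma dual_numbers_Z2_X_mod_X2: "\<exists>n. dual_numbers Z2_X_mod_X2 n"
proof -
  define F where "F = residue_ring 2"
  have Fsimps: "carrier F = {0, 1}" "\<zero>\<^bsub>F\<^esub> = 0" "\<one>\<^bsub>F\<^esub> = 1" "0 \<oplus>\<^bsub>F\<^esub> 1 = 1" "1 \<oplus>\<^bsub>F\<^esub> 1 = 0" "1 \<oplus>\<^bsub>F\<^esub> 0 = 1" "0 \<oplus>\<^bsub>F\<^esub> 0 = 0"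
    unfolding F_def residue_ring_def by auto
  interpret F: field F
    using residues_prime.is_field[of 2] unfolding residues_prime_def F_def by simp
  define P where "P = poly_ring F"
  interpret P: cring P unfolding P_def by (rule F.univ_poly_is_cring[OF F.carrier_is_subring])
  define Y where "Y = X\<^bsub>F\<^esub> [^]\<^bsub>P\<^esub> (2::nat)"
  have X: "X\<^bsub>F\<^esub> \<in> carrier P" unfolding P_def by (rule F.var_closed(1)[OF F.carrier_is_subring])
  have Y: "Y \<in> carrier P" unfolding Y_def using X by simp
  \<comment> \<open>Polynomials are coefficient lists with the leading coefficient first.\<close>
  have Y_eq: "Y = [1, 0, 0]"
    using F.unitary_monom_eq_var_pow[OF F.carrier_is_subring, of 2] Fsimps
    unfolding Y_def P_def by (simp add: F.monom_def numeral_2_eq_2)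
  have XX: "X\<^bsub>F\<^esub> \<otimes>\<^bsub>P\<^esub> X\<^bsub>F\<^esub> = Y" unfolding Y_def using X by (simp add: P.nat_pow_Suc numeral_2_eq_2)
  define I where "I = PIdl\<^bsub>P\<^esub> Y"
  interpret I: ideal I P unfolding I_def by (rule P.cgenideal_ideal[OF Y])
  define Q where "Q = P Quot I"
  have Q_eq: "Z2_X_mod_X2 = Q"
    unfolding Z2_X_mod_X2_def Q_def I_def Y_def P_def F_def by (simp add: Let_def)
  interpret Q: cring Q unfolding Q_def by (rule I.quotient_is_cring[OF P.is_cring])
  let ?c = "\<lambda>p. I +>\<^bsub>P\<^esub> p"
  have Qsimps: "\<zero>\<^bsub>Q\<^esub> = I" "\<one>\<^bsub>Q\<^esub> = ?c \<one>\<^bsub>P\<^esub>" "carrier Q = ?c ` carrier P"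
    unfolding Q_def FactRing_def by (auto simp: A_RCOSETS_def')
  have Qadd: "?c p \<oplus>\<^bsub>Q\<^esub> ?c q = ?c (p \<oplus>\<^bsub>P\<^esub> q)" and Qmult: "?c p \<otimes>\<^bsub>Q\<^esub> ?c q = ?c (p \<otimes>\<^bsub>P\<^esub> q)"
    if "p \<in> carrier P" "q \<in> carrier P" for p q
    using that I.a_rcos_sum I.rcoset_mult_add unfolding Q_def FactRing_def by auto
  have zero_iff: "?c p = I \<longleftrightarrow> p \<in> I" if "p \<in> carrier P" for p
    using that I.a_rcos_const I.a_rcos_self by blast
  have P_ops: "\<one>\<^bsub>P\<^esub> = [1]" "\<zero>\<^bsub>P\<^esub> = []" "X\<^bsub>F\<^esub> = [1, 0]"
    unfolding P_def var_def by (simp_all add: univ_poly_one univ_poly_zero Fsimps)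
  have P_add: "\<one>\<^bsub>P\<^esub> \<oplus>\<^bsub>P\<^esub> X\<^bsub>F\<^esub> = [1, 1]" "\<one>\<^bsub>P\<^esub> \<oplus>\<^bsub>P\<^esub> \<one>\<^bsub>P\<^esub> = \<zero>\<^bsub>P\<^esub>"
    unfolding P_ops unfolding P_def by (simp_all add: univ_poly_add Fsimps)
  have "X\<^bsub>F\<^esub> \<notin> I"
  proof
    assume "X\<^bsub>F\<^esub> \<in> I"
    then obtain q where q: "q \<in> carrier P" "X\<^bsub>F\<^esub> = q \<otimes>\<^bsub>P\<^esub> Y" unfolding I_def cgenideal_def by blast
    then have "X\<^bsub>F\<^esub> = Y \<otimes>\<^bsub>P\<^esub> q" using P.m_comm[OF q(1) Y] by simp
    then have "Y divides\<^bsub>P\<^esub> X\<^bsub>F\<^esub>" unfolding factor_def using q(1) by blast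
    then have "Y pdivides\<^bsub>F\<^esub> X\<^bsub>F\<^esub>" unfolding pdivides_def P_def .
    then have "degree Y \<le> degree X\<^bsub>F\<^esub>"
      using F.pdivides_imp_degree_le[OF F.carrier_is_subring _ _ _ \<open>Y pdivides\<^bsub>F\<^esub> X\<^bsub>F\<^esub>\<close>] X Y P_ops(3)
      unfolding P_def by simp
    then show False unfolding Y_eq P_ops by simp
  qed
  then have ne: "?c X\<^bsub>F\<^esub> \<noteq> I" using zero_iff[OF X] by simp
  have cases: "?c p \<in> {I, ?c \<one>\<^bsub>P\<^esub>, ?c X\<^bsub>F\<^esub>, ?c (\<one>\<^bsub>P\<^esub> \<oplus>\<^bsub>P\<^esub> X\<^bsub>F\<^esub>)}" if p: "p \<in> carrier P" for p
  proof -
    let ?q = "F.pdiv p Y" and ?r = "F.pmod p Y"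
    note K = F.carrier_is_subfield
    have q: "?q \<in> carrier P" and r: "?r \<in> carrier P"
      using F.long_division_closed[OF K] p Y unfolding P_def by blast+
    have eq: "p = (Y \<otimes>\<^bsub>P\<^esub> ?q) \<oplus>\<^bsub>P\<^esub> ?r"
      using F.pdiv_pmod[OF K] p Y unfolding P_def by blast
    have deg: "?r = [] \<or> degree ?r < 2"
      using F.pmod_degree[OF K, of p Y] p Y Y_eq unfolding P_def by auto
    have "p \<ominus>\<^bsub>P\<^esub> ?r = ?q \<otimes>\<^bsub>P\<^esub> Y"
    proof -
      have "(Y \<otimes>\<^bsub>P\<^esub> ?q) \<oplus>\<^bsub>P\<^esub> ?r \<ominus>\<^bsub>P\<^esub> ?r = ?q \<otimes>\<^bsub>P\<^esub> Y" using q r Y by algebra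
      then show ?thesis using eq by simp
    qed
    then have "p \<ominus>\<^bsub>P\<^esub> ?r \<in> I" unfolding I_def cgenideal_def using q by blast
    then have "?c p = ?c ?r" using P.quotient_eq_iff_same_a_r_cos[OF I.ideal_axioms p r] by simp
    \<comment> \<open>At most two entries, each 0 or 1, without a leading zero: the polynomials 0,
      1, \<open>X\<close> and \<open>1 + X\<close>.\<close>
    moreover have "?r \<in> {[], [1], [1, 0], [1, 1]}"
    proof -
      have "set ?r \<subseteq> {0, 1}" "?r \<noteq> [] \<Longrightarrow> hd ?r \<noteq> 0"
        using r unfolding P_def univ_poly_carrier[symmetric] polynomial_def Fsimps by auto
      moreover have "length ?r \<le> 2" using deg by auto
      ultimately show ?thesis
        by (cases ?r; cases "tl ?r"; cases "tl (tl ?r)") auto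
    qed
    moreover have "?c [] = I" using zero_iff[of "[]"] P_ops(2) P.zero_closed I.zero_closed by simp
    ultimately show ?thesis unfolding P_ops P_add(1)[unfolded P_ops] by (elim insertE emptyE) simp_all
  qed
  have "dual_numbers Q (?c X\<^bsub>F\<^esub>)"
    unfolding dual_numbers_def
  proof (intro conjI)
    show "?c X\<^bsub>F\<^esub> \<otimes>\<^bsub>Q\<^esub> ?c X\<^bsub>F\<^esub> = \<zero>\<^bsub>Q\<^esub>"
      using Qmult[OF X X] zero_iff[OF Y] P.cgenideal_self[OF Y] by (simp add: XX Qsimps I_def)
    show "\<one>\<^bsub>Q\<^esub> \<oplus>\<^bsub>Q\<^esub> \<one>\<^bsub>Q\<^esub> = \<zero>\<^bsub>Q\<^esub>"
      using Qadd[of "\<one>\<^bsub>P\<^esub>" "\<one>\<^bsub>P\<^esub>"] P_add(2) zero_iff[of "\<zero>\<^bsub>P\<^esub>"] I.zero_closed by (simp add: Qsimps)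
    have "\<one>\<^bsub>Q\<^esub> \<oplus>\<^bsub>Q\<^esub> ?c X\<^bsub>F\<^esub> = ?c (\<one>\<^bsub>P\<^esub> \<oplus>\<^bsub>P\<^esub> X\<^bsub>F\<^esub>)" using Qadd X by (simp add: Qsimps)
    moreover have "carrier Q = {I, ?c \<one>\<^bsub>P\<^esub>, ?c X\<^bsub>F\<^esub>, ?c (\<one>\<^bsub>P\<^esub> \<oplus>\<^bsub>P\<^esub> X\<^bsub>F\<^esub>)}"
    proof
      show "carrier Q \<subseteq> {I, ?c \<one>\<^bsub>P\<^esub>, ?c X\<^bsub>F\<^esub>, ?c (\<one>\<^bsub>P\<^esub> \<oplus>\<^bsub>P\<^esub> X\<^bsub>F\<^esub>)}"
        using cases unfolding Qsimps by blast
      show "{I, ?c \<one>\<^bsub>P\<^esub>, ?c X\<^bsub>F\<^esub>, ?c (\<one>\<^bsub>P\<^esub> \<oplus>\<^bsub>P\<^esub> X\<^bsub>F\<^esub>)} \<subseteq> carrier Q"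
        using X Q.zero_closed unfolding Qsimps by auto
    qed
    ultimately show "carrier Q = {\<zero>\<^bsub>Q\<^esub>, \<one>\<^bsub>Q\<^esub>, ?c X\<^bsub>F\<^esub>, \<one>\<^bsub>Q\<^esub> \<oplus>\<^bsub>Q\<^esub> ?c X\<^bsub>F\<^esub>}"
      by (simp add: Qsimps)
  qed (use ne X Q.is_cring in \<open>simp_all add: Qsimps\<close>)
  then show ?thesis unfolding Q_eq by blast
qed

section \<open>Factors without non-trivial idempotents\<close>

context cring
begin

text \<open>Squares of non-units \<open>x\<close> vanish because \<open>x\<^sup>2 \<in> {0, x}\<close>; so \<open>x \<mapsto> 1 + x\<close> embeds the non-units
  into the units.\<close>
lemma connected_few_units_cases:
  assumes one: "\<one> \<noteq> \<zero>"
    and conn: "\<And>x. x \<in> carrier R \<Longrightarrow> x \<otimes> x = x \<Longrightarrow> x = \<zero> \<or> x = \<one>"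
    and U: "finite (Units R)" "card (Units R) \<le> 2"
    and small: "\<And>m. m \<in> carrier R - Units R \<Longrightarrow> finite (PIdl m) \<and> card (PIdl m) \<le> 2"
  obtains "carrier R = {\<zero>, \<one>}"
    | u where "carrier R = {\<zero>, \<one>, u}" "u \<in> Units R" "u \<noteq> \<zero>" "u \<noteq> \<one>"
    | n where "n \<in> carrier R - Units R" "n \<noteq> \<zero>" "n \<otimes> n = \<zero>" "\<one> \<oplus> n \<in> Units R"
      "carrier R = {\<zero>, \<one>, n, \<one> \<oplus> n}"
proof -
  let ?N = "carrier R - Units R"
  have zero: "\<zero> \<in> ?N" using one by (auto simp: Units_def)
  have sq: "x \<otimes> x = \<zero>" if x: "x \<in> ?N" for x
  proof (rule ccontr)
    assume "x \<otimes> x \<noteq> \<zero>"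
    have xc: "x \<in> carrier R" using x by blast
    have "r \<otimes> x \<in> PIdl x" if "r \<in> carrier R" for r using that unfolding cgenideal_def by blast
    from this[of \<zero>] this[of x] have "{\<zero>, x, x \<otimes> x} \<subseteq> PIdl x"
      using cgenideal_self[OF xc] xc by simp
    then have "card {\<zero>, x, x \<otimes> x} \<le> 2" using small[OF x] card_mono le_trans by meson
    moreover have "x \<noteq> \<zero>" using \<open>x \<otimes> x \<noteq> \<zero>\<close> by auto
    ultimately have "x \<otimes> x = x" using \<open>x \<otimes> x \<noteq> \<zero>\<close> by (auto simp: card_insert_if split: if_splits)
    then have "x = \<one>" using conn xc \<open>x \<noteq> \<zero>\<close> by blast
    then show False using x by simp
  qed
  have unit: "\<one> \<oplus> x \<in> Units R" if x: "x \<in> ?N" for x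
  proof -
    have xc: "x \<in> carrier R" using x by blast
    have "(\<one> \<oplus> x) \<otimes> (\<one> \<ominus> x) = \<one> \<ominus> x \<otimes> x" using xc by algebra
    then have "(\<one> \<oplus> x) \<otimes> (\<one> \<ominus> x) = \<one>" using sq[OF x] by (simp add: minus_eq)
    moreover from this have "(\<one> \<ominus> x) \<otimes> (\<one> \<oplus> x) = \<one>" using xc m_comm by simp
    ultimately show ?thesis using xc unfolding Units_def by auto
  qed
  have c: "carrier R = ?N \<union> Units R" using Units_closed by blast
  show ?thesis
  proof (cases "?N = {\<zero>}")
    case True
    have cT: "carrier R = {\<zero>} \<union> Units R" unfolding True[symmetric] by (rule c)
    \<comment> \<open>The case \<open>u = 1\<close> is allowed, so that one and two units are
      treated alike.\<close>
    have "\<exists>u. Units R = {\<one>, u}"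
    proof (cases "Units R = {\<one>}")
      case False
      then obtain u where u: "u \<in> Units R" "u \<noteq> \<one>" using Units_one_closed by blast
      then have "{\<one>, u} = Units R" using U by (intro card_seteq) auto
      then show ?thesis by metis
    qed auto
    then obtain u where u: "Units R = {\<one>, u}" by blast
    have "u \<noteq> \<zero>" using zero u by auto
    show ?thesis
    proof (cases "u = \<one>")
      case u1: True
      show ?thesis by (rule that(1)) (use cT u u1 in auto)
    next
      case False
      show ?thesis
        by (rule that(2)[OF _ _ \<open>u \<noteq> \<zero>\<close> False]) (use cT u in auto)
    qed
  next
    case False
    then obtain n where n: "n \<in> ?N" "n \<noteq> \<zero>" using zero by blast
    have nc: "n \<in> carrier R" using n by blast
    have d: "\<one> \<oplus> n \<noteq> \<one>" using four_elements_distinct[OF nc n(2) sq[OF n(1)]] by blast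
    \<comment> \<open>Two distinct units already exhaust the bound, so any other non-unit
      \<open>x\<close> has \<open>1 + x\<close> among them.\<close>
    have UR: "{\<one>, \<one> \<oplus> n} = Units R"
      using U unit[OF n(1)] d by (intro card_seteq) auto
    have "x = \<zero> \<or> x = n" if x: "x \<in> ?N" for x
    proof -
      have xc: "x \<in> carrier R" using x by blast
      have "\<one> \<oplus> x = \<one> \<or> \<one> \<oplus> x = \<one> \<oplus> n" using unit[OF x] UR by blast
      then show ?thesis using xc nc add_self_cancel[of \<one> x] by auto
    qed
    then have "?N = {\<zero>, n}" using zero n(1) by blast
    then have "carrier R = {\<zero>, n} \<union> {\<one>, \<one> \<oplus> n}" using c UR by simp
    then have "carrier R = {\<zero>, \<one>, n, \<one> \<oplus> n}" by auto
    then show ?thesis using that(3)[OF n sq[OF n(1)] unit[OF n(1)]] by blast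
  qed
qed

text \<open>The value of \<open>1 + 1\<close> decides: cancellation excludes 1 and
  \<open>1 + n\<close>, leaving 0 for the dual numbers and \<open>n\<close> for the integers modulo
  4.\<close>

lemma iso_four_elements:
  assumes n: "n \<in> carrier R" "n \<noteq> \<zero>" "n \<otimes> n = \<zero>" and c: "carrier R = {\<zero>, \<one>, n, \<one> \<oplus> n}"
  shows "R \<simeq> residue_ring 4 \<or> R \<simeq> Z2_X_mod_X2"
proof -
  note d = four_elements_distinct[OF n]
  have "\<one> \<oplus> \<one> \<in> {\<zero>, \<one>, n, \<one> \<oplus> n}" using c by blast
  moreover have "\<one> \<oplus> \<one> \<noteq> \<one>" using add_self_cancel[of \<one> \<one>] d by auto
  moreover have "\<one> \<oplus> \<one> \<noteq> \<one> \<oplus> n" using d n(1) by auto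
  ultimately consider "\<one> \<oplus> \<one> = \<zero>" | "\<one> \<oplus> \<one> = n" by blast
  then show ?thesis
  proof cases
    case 1
    then have "dual_numbers R n" using n c is_cring unfolding dual_numbers_def by blast
    moreover obtain m where "dual_numbers Z2_X_mod_X2 m" using dual_numbers_Z2_X_mod_X2 by blast
    ultimately have "R \<simeq> Z2_X_mod_X2" by (rule dual_numbers_iso)
    then show ?thesis ..
  next
    case 2
    then show ?thesis using iso_residue_ring_4[OF n 2 c] by blast
  qed
qed

end

section \<open>The classification\<close>

lemma RDirProd_iso_cong: "A \<simeq> A' \<Longrightarrow> B \<simeq> B' \<Longrightarrow> RDirProd A B \<simeq> RDirProd A' B'"
  unfolding is_ring_iso_def using RDirProd_iso6 by blast

lemma RDirProd_iso_comm: "RDirProd A B \<simeq> RDirProd B A"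
  unfolding is_ring_iso_def using RDirProd_iso1 by blast

lemma RDirProd_iso_left_comm: "RDirProd A (RDirProd B C) \<simeq> RDirProd B (RDirProd A C)"
proof -
  have 1: "RDirProd A (RDirProd B C) \<simeq> RDirProd (RDirProd A B) C"
    unfolding is_ring_iso_def using RDirProd_iso2 by blast
  have 2: "RDirProd (RDirProd A B) C \<simeq> RDirProd (RDirProd B A) C"
    by (rule RDirProd_iso_cong[OF RDirProd_iso_comm ring_iso_refl])
  have 3: "RDirProd (RDirProd B A) C \<simeq> RDirProd B (RDirProd A C)"
    unfolding is_ring_iso_def using RDirProd_iso3 by blast
  show ?thesis by (rule ring_iso_trans[OF 1 ring_iso_trans[OF 2 3]])
qed

lemma claw_free_cong:
  assumes "cring R" "R \<simeq> S" "claw_free R"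
  shows "claw_free S"
  using assms ring.ring_iso_claw_free unfolding is_ring_iso_def cring_def by blast

text \<open>Folds the list of the theorem into one predicate, to be transported along isomorphisms
  between rings of different types.\<close>

definition exceptional :: "('a, 'b) ring_scheme \<Rightarrow> bool"
  where "exceptional R \<longleftrightarrow>
    R \<simeq> RDirProd (residue_ring 2) (RDirProd (residue_ring 2) (residue_ring 2)) \<or>
    R \<simeq> RDirProd (residue_ring 2) (residue_ring 2) \<or>
    R \<simeq> RDirProd (residue_ring 2) (residue_ring 3) \<or>
    R \<simeq> RDirProd (residue_ring 2) (residue_ring 4) \<or>
    R \<simeq> RDirProd (residue_ring 2) Z2_X_mod_X2 \<or>
    R \<simeq> RDirProd (residue_ring 3) (residue_ring 3)"

lemma exceptional_cong: "R \<simeq> S \<Longrightarrow> exceptional S \<Longrightarrow> exceptional R"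
  unfolding exceptional_def by (elim disjE) (drule (1) ring_iso_trans, simp)+

text \<open>For the non-unit \<open>m = (1, 0)\<close> of \<open>B \<times> C\<close> the ideal
  \<open>(m)\<close> is a copy of \<open>B\<close>, so the claw bound leaves \<open>B\<close> only 0
  and 1.\<close>

lemma claw_free_three_factors_iso:
  assumes "cring A" "cring B" "cring C"
    and "\<one>\<^bsub>A\<^esub> \<noteq> \<zero>\<^bsub>A\<^esub>" "\<one>\<^bsub>B\<^esub> \<noteq> \<zero>\<^bsub>B\<^esub>" "\<one>\<^bsub>C\<^esub> \<noteq> \<zero>\<^bsub>C\<^esub>"
    and cf: "claw_free (RDirProd A (RDirProd B C))"
  shows "B \<simeq> residue_ring 2"
proof -
  interpret A: cring A by fact
  interpret B: cring B by fact
  interpret C: cring C by fact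
  interpret BC: cring "RDirProd B C" by (rule RDirProd_cring) fact+
  define m where "m = (\<one>\<^bsub>B\<^esub>, \<zero>\<^bsub>C\<^esub>)"
  have m: "m \<in> carrier (RDirProd B C) - Units (RDirProd B C)"
    using assms(6) by (auto simp: m_def Units_RDirProd Units_def)
  note * = claw_free_RDirProd[OF A.is_cring BC.is_cring assms(4) cf m]
  have "(b, \<zero>\<^bsub>C\<^esub>) \<in> PIdl\<^bsub>RDirProd B C\<^esub> m" if "b \<in> carrier B" for b
    using that unfolding cgenideal_def m_def by (auto intro!: exI[of _ b] exI[of _ "\<zero>\<^bsub>C\<^esub>"])
  then have sub: "(\<lambda>b. (b, \<zero>\<^bsub>C\<^esub>)) ` carrier B \<subseteq> PIdl\<^bsub>RDirProd B C\<^esub> m" by blast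
  have inj: "inj_on (\<lambda>b. (b, \<zero>\<^bsub>C\<^esub>)) (carrier B)" by (simp add: inj_on_def)
  have fin: "finite (carrier B)" using finite_subset[OF sub *(2)] finite_imageD[OF _ inj] by blast
  have "card (carrier B) \<le> card (PIdl\<^bsub>RDirProd B C\<^esub> m)"
    using card_inj_on_le[OF inj sub *(2)] .
  moreover have "1 \<le> card (Units A)" using *(1) A.Units_one_closed by (metis One_nat_def Suc_leI card_gt_0_iff empty_iff)
  ultimately have "1 * card (carrier B) \<le> card (Units A) * card (PIdl\<^bsub>RDirProd B C\<^esub> m)"
    by (rule mult_le_mono[rotated])
  then have "card (carrier B) \<le> card {\<zero>\<^bsub>B\<^esub>, \<one>\<^bsub>B\<^esub>}" using *(3) assms(5) by simp
  then have "{\<zero>\<^bsub>B\<^esub>, \<one>\<^bsub>B\<^esub>} = carrier B" by (intro card_seteq fin) auto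
  then show ?thesis using B.iso_residue_ring_2 assms(5) by metis
qed

text \<open>Claw-freeness is invariant under permuting factors, so each of the three can be moved to
  the middle position, the one about which the preceding lemma speaks.\<close>

lemma claw_free_three_factors:
  assumes "cring A" "cring B" "cring C"
    and "\<one>\<^bsub>A\<^esub> \<noteq> \<zero>\<^bsub>A\<^esub>" "\<one>\<^bsub>B\<^esub> \<noteq> \<zero>\<^bsub>B\<^esub>" "\<one>\<^bsub>C\<^esub> \<noteq> \<zero>\<^bsub>C\<^esub>"
    and cf: "claw_free (RDirProd A (RDirProd B C))"
  shows "exceptional (RDirProd A (RDirProd B C))"
proof -
  have c: "cring (RDirProd A (RDirProd B C))"
    using assms(1-3) by (intro RDirProd_cring)
  have "claw_free (RDirProd A (RDirProd C B))"
    using claw_free_cong[OF c _ cf] RDirProd_iso_cong[OF ring_iso_refl RDirProd_iso_comm] by blast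
  then have C: "C \<simeq> residue_ring 2"
    using claw_free_three_factors_iso[of A C B] assms by blast
  have "claw_free (RDirProd B (RDirProd A C))"
    using claw_free_cong[OF c _ cf] RDirProd_iso_left_comm by blast
  then have A: "A \<simeq> residue_ring 2"
    using claw_free_three_factors_iso[of B A C] assms by blast
  have B: "B \<simeq> residue_ring 2" using claw_free_three_factors_iso[of A B C] assms by blast
  show ?thesis unfolding exceptional_def
    using RDirProd_iso_cong[OF A RDirProd_iso_cong[OF B C]] by blast
qed

text \<open>Separates the product bound: \<open>m = 0\<close> limits the units,
  \<open>|U(A)| \<ge> 1\<close> limits the ideals, and \<open>m \<noteq> 0\<close> uses up the whole
  bound since \<open>(m)\<close> contains 0 and \<open>m\<close>.\<close>

lemma claw_free_RDirProd_units:
  assumes "cring A" "cring B" and "\<one>\<^bsub>A\<^esub> \<noteq> \<zero>\<^bsub>A\<^esub>" "\<one>\<^bsub>B\<^esub> \<noteq> \<zero>\<^bsub>B\<^esub>" and cf: "claw_free (RDirProd A B)"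
  shows "finite (Units A)" "card (Units A) \<le> 2"
    and "m \<in> carrier B - Units B \<Longrightarrow> finite (PIdl\<^bsub>B\<^esub> m) \<and> card (PIdl\<^bsub>B\<^esub> m) \<le> 2"
    and "m \<in> carrier B - Units B \<Longrightarrow> m \<noteq> \<zero>\<^bsub>B\<^esub> \<Longrightarrow> u \<in> Units A \<Longrightarrow> u = \<one>\<^bsub>A\<^esub>"
proof -
  interpret A: cring A by fact
  interpret B: cring B by fact
  note claw = claw_free_RDirProd[OF assms(1,2,3) cf]
  have zero: "\<zero>\<^bsub>B\<^esub> \<in> carrier B - Units B" using assms(4) by (auto simp: Units_def)
  show fin: "finite (Units A)" using claw(1)[OF zero] .
  have U: "1 \<le> card (Units A)"
    using fin A.Units_one_closed by (metis One_nat_def Suc_leI card_gt_0_iff empty_iff)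
  have P: "1 \<le> card (PIdl\<^bsub>B\<^esub> m)" if "m \<in> carrier B - Units B" for m
    using claw(2)[OF that] B.cgenideal_self[of m] that
    by (metis DiffD1 One_nat_def Suc_leI card_gt_0_iff empty_iff)
  have "card (Units A) * 1 \<le> card (Units A) * card (PIdl\<^bsub>B\<^esub> \<zero>\<^bsub>B\<^esub>)"
    by (rule mult_le_mono2[OF P[OF zero]])
  then show "card (Units A) \<le> 2" using claw(3)[OF zero] by linarith
  assume m: "m \<in> carrier B - Units B"
  have "1 * card (PIdl\<^bsub>B\<^esub> m) \<le> card (Units A) * card (PIdl\<^bsub>B\<^esub> m)"
    by (rule mult_le_mono1[OF U])
  then show "finite (PIdl\<^bsub>B\<^esub> m) \<and> card (PIdl\<^bsub>B\<^esub> m) \<le> 2" using claw(2,3)[OF m] by linarith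
  assume m0: "m \<noteq> \<zero>\<^bsub>B\<^esub>" and u: "u \<in> Units A"
  show "u = \<one>\<^bsub>A\<^esub>"
  proof (rule ccontr)
    assume "u \<noteq> \<one>\<^bsub>A\<^esub>"
    then have "2 \<le> card (Units A)"
      using card_mono[OF fin, of "{\<one>\<^bsub>A\<^esub>, u}"] u by simp
    moreover have "{\<zero>\<^bsub>B\<^esub>, m} \<subseteq> PIdl\<^bsub>B\<^esub> m"
    proof -
      have "\<zero>\<^bsub>B\<^esub> \<otimes>\<^bsub>B\<^esub> m \<in> PIdl\<^bsub>B\<^esub> m" unfolding cgenideal_def using B.zero_closed by blast
      then show ?thesis using m B.cgenideal_self[of m] by simp
    qed
    then have "2 \<le> card (PIdl\<^bsub>B\<^esub> m)"
      using card_mono[OF claw(2)[OF m], of "{\<zero>\<^bsub>B\<^esub>, m}"] m0 by simp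
    ultimately have "2 * 2 \<le> card (Units A) * card (PIdl\<^bsub>B\<^esub> m)" by (rule mult_le_mono)
    then show False using claw(3)[OF m] by simp
  qed
qed

text \<open>Each factor has one of three shapes. The last clause of
  \<open>claw_free_RDirProd_units\<close> forbids a nonzero non-unit in one factor against a unit
  other than 1 in the other; this removes three of the nine combinations, and the rest are on the
  list up to order.\<close>

lemma claw_free_two_factors:
  assumes "cring A" "cring B" and A1: "\<one>\<^bsub>A\<^esub> \<noteq> \<zero>\<^bsub>A\<^esub>" and B1: "\<one>\<^bsub>B\<^esub> \<noteq> \<zero>\<^bsub>B\<^esub>"
    and cf: "claw_free (RDirProd A B)"
    and connA: "\<And>x. x \<in> carrier A \<Longrightarrow> x \<otimes>\<^bsub>A\<^esub> x = x \<Longrightarrow> x = \<zero>\<^bsub>A\<^esub> \<or> x = \<one>\<^bsub>A\<^esub>"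
    and connB: "\<And>x. x \<in> carrier B \<Longrightarrow> x \<otimes>\<^bsub>B\<^esub> x = x \<Longrightarrow> x = \<zero>\<^bsub>B\<^esub> \<or> x = \<one>\<^bsub>B\<^esub>"
  shows "exceptional (RDirProd A B)"
proof -
  interpret A: cring A by fact
  interpret B: cring B by fact
  have cf': "claw_free (RDirProd B A)"
    by (rule claw_free_cong[OF RDirProd_cring[OF assms(1,2)] RDirProd_iso_comm cf])
  note AB = claw_free_RDirProd_units[OF assms(1,2) A1 B1 cf]
    and BA = claw_free_RDirProd_units[OF assms(2,1) B1 A1 cf']
  have swap: "RDirProd A B \<simeq> RDirProd S T" if "A \<simeq> T" "B \<simeq> S"
    for S :: "('x, 'y) ring_scheme" and T :: "('z, 'w) ring_scheme"
    by (rule ring_iso_trans[OF RDirProd_iso_comm RDirProd_iso_cong[OF that(2,1)]])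
  show ?thesis
  proof (rule A.connected_few_units_cases[OF A1 connA AB(1,2) BA(3)])
    assume "carrier A = {\<zero>\<^bsub>A\<^esub>, \<one>\<^bsub>A\<^esub>}"
    then have A: "A \<simeq> residue_ring 2" using A.iso_residue_ring_2 A1 by blast
    note iso = RDirProd_iso_cong[OF A]
    show ?thesis
    proof (rule B.connected_few_units_cases[OF B1 connB BA(1,2) AB(3)])
      assume "carrier B = {\<zero>\<^bsub>B\<^esub>, \<one>\<^bsub>B\<^esub>}"
      then have "B \<simeq> residue_ring 2" using B.iso_residue_ring_2 B1 by blast
      then show ?thesis unfolding exceptional_def using iso by blast
    next
      fix u assume "carrier B = {\<zero>\<^bsub>B\<^esub>, \<one>\<^bsub>B\<^esub>, u}" "u \<noteq> \<zero>\<^bsub>B\<^esub>" "u \<noteq> \<one>\<^bsub>B\<^esub>"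
      then have "B \<simeq> residue_ring 3" using B.iso_residue_ring_3 B1 by blast
      then show ?thesis unfolding exceptional_def using iso by blast
    next
      fix n assume "n \<in> carrier B - Units B" "n \<noteq> \<zero>\<^bsub>B\<^esub>" "n \<otimes>\<^bsub>B\<^esub> n = \<zero>\<^bsub>B\<^esub>"
        "carrier B = {\<zero>\<^bsub>B\<^esub>, \<one>\<^bsub>B\<^esub>, n, \<one>\<^bsub>B\<^esub> \<oplus>\<^bsub>B\<^esub> n}"
      then have "B \<simeq> residue_ring 4 \<or> B \<simeq> Z2_X_mod_X2" using B.iso_four_elements by blast
      then show ?thesis unfolding exceptional_def using iso[of B "residue_ring 4"] iso[of B Z2_X_mod_X2] by blast
    qed
  next
    fix v assume v: "carrier A = {\<zero>\<^bsub>A\<^esub>, \<one>\<^bsub>A\<^esub>, v}" "v \<in> Units A" "v \<noteq> \<zero>\<^bsub>A\<^esub>" "v \<noteq> \<one>\<^bsub>A\<^esub>"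
    then have A: "A \<simeq> residue_ring 3" using A.iso_residue_ring_3 A1 by blast
    show ?thesis
    proof (rule B.connected_few_units_cases[OF B1 connB BA(1,2) AB(3)])
      assume "carrier B = {\<zero>\<^bsub>B\<^esub>, \<one>\<^bsub>B\<^esub>}"
      then have "B \<simeq> residue_ring 2" using B.iso_residue_ring_2 B1 by blast
      then show ?thesis unfolding exceptional_def using swap[OF A] by blast
    next
      fix u assume "carrier B = {\<zero>\<^bsub>B\<^esub>, \<one>\<^bsub>B\<^esub>, u}" "u \<noteq> \<zero>\<^bsub>B\<^esub>" "u \<noteq> \<one>\<^bsub>B\<^esub>"
      then have "B \<simeq> residue_ring 3" using B.iso_residue_ring_3 B1 by blast
      then show ?thesis unfolding exceptional_def using RDirProd_iso_cong[OF A] by blast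
    next
      fix n assume "n \<in> carrier B - Units B" "n \<noteq> \<zero>\<^bsub>B\<^esub>"
      then show ?thesis using AB(4) v by blast
    qed
  next
    fix n assume n: "n \<in> carrier A - Units A" "n \<noteq> \<zero>\<^bsub>A\<^esub>" "n \<otimes>\<^bsub>A\<^esub> n = \<zero>\<^bsub>A\<^esub>"
        "carrier A = {\<zero>\<^bsub>A\<^esub>, \<one>\<^bsub>A\<^esub>, n, \<one>\<^bsub>A\<^esub> \<oplus>\<^bsub>A\<^esub> n}"
    then have A: "A \<simeq> residue_ring 4 \<or> A \<simeq> Z2_X_mod_X2" using A.iso_four_elements by blast
    show ?thesis
    proof (rule B.connected_few_units_cases[OF B1 connB BA(1,2) AB(3)])
      assume "carrier B = {\<zero>\<^bsub>B\<^esub>, \<one>\<^bsub>B\<^esub>}"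
      then have "B \<simeq> residue_ring 2" using B.iso_residue_ring_2 B1 by blast
      then show ?thesis unfolding exceptional_def using A swap[of "residue_ring 4"] swap[of Z2_X_mod_X2] by blast
    next
      fix u assume "u \<in> Units B" "u \<noteq> \<one>\<^bsub>B\<^esub>"
      then show ?thesis using BA(4) n by blast
    next
      fix m assume m: "m \<in> carrier B - Units B" "m \<noteq> \<zero>\<^bsub>B\<^esub>" "m \<otimes>\<^bsub>B\<^esub> m = \<zero>\<^bsub>B\<^esub>"
        "\<one>\<^bsub>B\<^esub> \<oplus>\<^bsub>B\<^esub> m \<in> Units B"
      \<comment> \<open>The nilpotent \<open>m\<close> itself provides the forbidden non-trivial
        unit opposite \<open>n\<close>.\<close>
      then have "\<one>\<^bsub>B\<^esub> \<oplus>\<^bsub>B\<^esub> m \<noteq> \<one>\<^bsub>B\<^esub>" using B.four_elements_distinct[of m] by blast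
      then show ?thesis using BA(4) n m by blast
    qed
  qed
qed

lemma claw_free_RDirProd_exceptional:
  assumes "cring A" "cring B" and A1: "\<one>\<^bsub>A\<^esub> \<noteq> \<zero>\<^bsub>A\<^esub>" and B1: "\<one>\<^bsub>B\<^esub> \<noteq> \<zero>\<^bsub>B\<^esub>"
    and cf: "claw_free (RDirProd A B)"
  shows "exceptional (RDirProd A B)"
proof -
  \<comment> \<open>Stated for fresh \<open>A\<close> and \<open>B\<close> of arbitrary types,
    because it is applied to the factors in both orders.\<close>
  have split: "exceptional (RDirProd A B)"
    if "cring A" "cring B" "\<one>\<^bsub>A\<^esub> \<noteq> \<zero>\<^bsub>A\<^esub>" "claw_free (RDirProd A B)"
      and x: "x \<in> carrier B" "x \<otimes>\<^bsub>B\<^esub> x = x" "x \<noteq> \<zero>\<^bsub>B\<^esub>" "x \<noteq> \<one>\<^bsub>B\<^esub>"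
    for A :: "('x, 'y) ring_scheme" and B :: "('z, 'w) ring_scheme" and x
  proof (rule cring.idempotent_imp_RDirProd[OF that(2) x])
    fix C D :: "('z, 'w) ring_scheme"
    assume CD: "cring C" "cring D" "\<one>\<^bsub>C\<^esub> \<noteq> \<zero>\<^bsub>C\<^esub>" "\<one>\<^bsub>D\<^esub> \<noteq> \<zero>\<^bsub>D\<^esub>" "B \<simeq> RDirProd C D"
    note iso = RDirProd_iso_cong[OF ring_iso_refl[of A] CD(5)]
    have "claw_free (RDirProd A (RDirProd C D))"
      by (rule claw_free_cong[OF RDirProd_cring[OF that(1,2)] iso that(4)])
    then have "exceptional (RDirProd A (RDirProd C D))"
      using claw_free_three_factors that(1,3) CD by blast
    then show ?thesis by (rule exceptional_cong[OF iso])
  qed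
  have cf': "claw_free (RDirProd B A)"
    by (rule claw_free_cong[OF RDirProd_cring[OF assms(1,2)] RDirProd_iso_comm cf])
  show ?thesis
  proof (rule ccontr)
    assume not: "\<not> exceptional (RDirProd A B)"
    then have not': "\<not> exceptional (RDirProd B A)"
      using exceptional_cong[OF RDirProd_iso_comm] by blast
    have "x = \<zero>\<^bsub>B\<^esub> \<or> x = \<one>\<^bsub>B\<^esub>" if "x \<in> carrier B" "x \<otimes>\<^bsub>B\<^esub> x = x" for x
      using split[OF assms(1,2) A1 cf that] not by blast
    moreover have "x = \<zero>\<^bsub>A\<^esub> \<or> x = \<one>\<^bsub>A\<^esub>" if "x \<in> carrier A" "x \<otimes>\<^bsub>A\<^esub> x = x" for x
      using split[OF assms(2,1) B1 cf' that] not' by blast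
    ultimately show False using claw_free_two_factors[OF assms] not by blast
  qed
qed

lemma (in cring) complement_of_line_graph_imp_exceptional:
  assumes "\<one> \<noteq> \<zero>" "\<not> is_local_ring R"
    and "complement_of_line_graph (upper_ideal_relation_graph R)"
  shows "exceptional R"
proof -
  have cf: "claw_free R" by (rule complement_of_line_graph_imp_claw_free) fact
  obtain x where x: "x \<in> carrier R - Units R" "\<one> \<ominus> x \<in> carrier R - Units R"
    using not_local_imp_comaximal_nonunits assms(1,2) by blast
  obtain e where e: "e \<in> carrier R" "e \<otimes> e = e" "e \<noteq> \<zero>" "e \<noteq> \<one>"
    using claw_free_imp_idempotent[OF cf x] by blast
  show ?thesis
  proof (rule idempotent_imp_RDirProd[OF e])
    fix A B :: "('a, 'b) ring_scheme"
    assume AB: "cring A" "cring B" "\<one>\<^bsub>A\<^esub> \<noteq> \<zero>\<^bsub>A\<^esub>" "\<one>\<^bsub>B\<^esub> \<noteq> \<zero>\<^bsub>B\<^esub>" and iso: "R \<simeq> RDirProd A B"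
    have "claw_free (RDirProd A B)" by (rule claw_free_cong[OF is_cring iso cf])
    then show ?thesis using exceptional_cong[OF iso] claw_free_RDirProd_exceptional[OF AB] by blast
  qed
qed

section \<open>The six rings\<close>

text \<open>Finite local rings with principal maximal ideal \<open>(p)\<close>, where
  \<open>p = 0\<close> for fields. Any two non-units then share the divisor \<open>p\<close>, so the
  graph of a product of two such rings depends only on the numbers \<open>k\<close> of units and
  \<open>l\<close> of non-units.\<close>

definition small_principal_local :: "('a, 'b) ring_scheme \<Rightarrow> nat \<Rightarrow> nat \<Rightarrow> bool"
  where "small_principal_local R k l \<longleftrightarrow> cring R \<and> finite (carrier R) \<and>
    card (Units R) = k \<and> card (carrier R - Units R) = l \<and>
    (\<exists>p \<in> carrier R - Units R. \<forall>x \<in> carrier R - Units R. \<exists>r \<in> carrier R. x = r \<otimes>\<^bsub>R\<^esub> p)"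

lemma small_principal_local_common_nonunit_divisor:
  assumes "small_principal_local R k l" and "x \<in> carrier R" "y \<in> carrier R"
  shows "common_nonunit_divisor R x y \<longleftrightarrow> x \<notin> Units R \<and> y \<notin> Units R"
proof -
  interpret cring R using assms(1) unfolding small_principal_local_def by blast
  show ?thesis
  proof
    assume "common_nonunit_divisor R x y"
    then show "x \<notin> Units R \<and> y \<notin> Units R" using not_common_nonunit_divisor_unit by blast
  next
    assume "x \<notin> Units R \<and> y \<notin> Units R"
    then have xy: "x \<in> carrier R - Units R" "y \<in> carrier R - Units R" using assms by auto
    obtain p where p: "p \<in> carrier R - Units R"
      "\<And>x. x \<in> carrier R - Units R \<Longrightarrow> \<exists>r \<in> carrier R. x = r \<otimes>\<^bsub>R\<^esub> p"
      using assms(1) unfolding small_principal_local_def by blast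
    show "common_nonunit_divisor R x y"
      using p(1) p(2)[OF xy(1)] p(2)[OF xy(2)] unfolding common_nonunit_divisor_def by blast
  qed
qed

lemma inj_into_bool:
  assumes "finite A" "card A \<le> 2"
  obtains i :: "'a \<Rightarrow> bool" where "inj_on i A"
  using card_le_inj[of A "UNIV :: bool set"] assms by auto

text \<open>Vertices in only one of the two maximal ideals \<open>N\<^sub>A \<times> B\<close> and \<open>A \<times> N\<^sub>B\<close> go to the edges
  of the 4-cycle on \<open>bool \<times> bool\<close>, opposite edges for the same ideal; all others go to
  isolated edges.\<close>
lemma complement_of_line_graph_two_factors:
  fixes A :: "('a, 'm) ring_scheme" and B :: "('b, 'n) ring_scheme"
  assumes A: "small_principal_local A k l" and B: "small_principal_local B k' l'"
    and "k * l' \<le> 2" "l * k' \<le> 2"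
  shows "complement_of_line_graph (upper_ideal_relation_graph (RDirProd A B))"
proof -
  interpret A: cring A using A unfolding small_principal_local_def by blast
  interpret B: cring B using B unfolding small_principal_local_def by blast
  interpret AB: cring "RDirProd A B" by (rule RDirProd_cring[OF A.is_cring B.is_cring])
  let ?NA = "carrier A - Units A" and ?NB = "carrier B - Units B"
  have UA: "Units A \<subseteq> carrier A" and UB: "Units B \<subseteq> carrier B"
    using A.Units_closed B.Units_closed by blast+
  have fin: "finite (carrier A)" "finite (carrier B)"
    using A B unfolding small_principal_local_def by blast+
  \<comment> \<open>These vertices lie in exactly one maximal ideal of the product; by
    \<open>k * l' \<le> 2\<close> a single bit tells them apart.\<close>
  have "finite (Units A \<times> ?NB)" "card (Units A \<times> ?NB) \<le> 2"
    using A B assms(3) fin UA finite_subset unfolding small_principal_local_def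
    by (auto simp: card_cartesian_product)
  then obtain i :: "'a \<times> 'b \<Rightarrow> bool" where i: "inj_on i (Units A \<times> ?NB)"
    by (rule inj_into_bool)
  have "finite (?NA \<times> Units B)" "card (?NA \<times> Units B) \<le> 2"
    using A B assms(4) fin UB finite_subset unfolding small_principal_local_def
    by (auto simp: card_cartesian_product)
  then obtain j :: "'a \<times> 'b \<Rightarrow> bool" where j: "inj_on j (?NA \<times> Units B)"
    by (rule inj_into_bool)
  \<comment> \<open>Edges \<open>f u\<close> and \<open>f v\<close> of the two kinds of cycle edges
    meet in the corner \<open>Inl (i u, j v)\<close>. An \<open>Inr\<close> edge carries its own
    vertex, hence is disjoint from all others, as befits an element of both maximal ideals.\<close>
  define f :: "'a \<times> 'b \<Rightarrow> (bool \<times> bool + ('a \<times> 'b) \<times> bool) set" where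
    "f v = (if fst v \<in> Units A then {Inl (i v, False), Inl (i v, True)}
      else if snd v \<in> Units B then {Inl (False, j v), Inl (True, j v)}
      else {Inr (v, False), Inr (v, True)})" for v
  have V: "carrier (RDirProd A B) - Units (RDirProd A B) = {v. fst v \<in> carrier A \<and> snd v \<in> carrier B \<and>
      (fst v \<in> Units A \<longrightarrow> snd v \<notin> Units B)}"
    by (auto simp: Units_RDirProd)
  have ii: "i u = i v \<longleftrightarrow> u = v" if "fst u \<in> Units A" "fst v \<in> Units A"
    "snd u \<in> carrier B" "snd v \<in> carrier B" "snd u \<notin> Units B" "snd v \<notin> Units B" for u v
    using inj_on_eq_iff[OF i, of u v] that by (simp add: mem_Times_iff)
  have jj: "j u = j v \<longleftrightarrow> u = v" if "snd u \<in> Units B" "snd v \<in> Units B"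
    "fst u \<in> carrier A" "fst v \<in> carrier A" "fst u \<notin> Units A" "fst v \<notin> Units A" for u v
    using inj_on_eq_iff[OF j, of u v] that by (simp add: mem_Times_iff)
  have disj: "f u \<inter> f v = {} \<longleftrightarrow> u \<noteq> v \<and>
      ((fst u \<notin> Units A \<and> fst v \<notin> Units A) \<or> (snd u \<notin> Units B \<and> snd v \<notin> Units B))"
    if "u \<in> carrier (RDirProd A B) - Units (RDirProd A B)"
      "v \<in> carrier (RDirProd A B) - Units (RDirProd A B)" for u v
    using that ii[of u v] jj[of u v] unfolding V f_def by auto
  show ?thesis
  proof (rule AB.complement_of_line_graph_ringI[where f = f])
    show "inj_on f (carrier (RDirProd A B) - Units (RDirProd A B))"
    proof (rule inj_onI)
      fix u v
      assume uv: "u \<in> carrier (RDirProd A B) - Units (RDirProd A B)"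
        "v \<in> carrier (RDirProd A B) - Units (RDirProd A B)" and eq: "f u = f v"
      show "u = v"
        using uv eq ii[of u v] jj[of u v] unfolding V f_def
        by (auto simp: doubleton_eq_iff split: if_splits)
    qed
    have "card (f v) = 2" for v unfolding f_def by simp
    then show "\<exists>p q. p \<noteq> q \<and> f v = {p, q}" for v by (metis card_2_iff)
    show "common_nonunit_divisor (RDirProd A B) u v \<longleftrightarrow> f u \<inter> f v = {}"
      if uv: "u \<in> carrier (RDirProd A B) - Units (RDirProd A B)"
        "v \<in> carrier (RDirProd A B) - Units (RDirProd A B)" "u \<noteq> v" for u v
    proof -
      obtain a b a' b' where eq: "u = (a, b)" "v = (a', b')" by (metis surj_pair)
      then have c: "a \<in> carrier A" "a' \<in> carrier A" "b \<in> carrier B" "b' \<in> carrier B"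
        using uv by auto
      show ?thesis
        using disj[OF uv(1,2)] uv(3) RDirProd_common_nonunit_divisor[OF A.is_cring B.is_cring c]
          small_principal_local_common_nonunit_divisor[OF A c(1,2)]
          small_principal_local_common_nonunit_divisor[OF B c(3,4)] unfolding eq by simp
    qed
  qed
qed

section \<open>The local factors on the list\<close>

lemma residue_ring_prime_Units:
  assumes "residues_prime p"
  shows "Units (residue_ring (int p)) = {1..int (p - 1)}"
  using residues_prime.res_prime_units_eq[OF assms] .

lemma small_principal_local_residue_ring_prime:
  assumes "residues_prime p"
  shows "small_principal_local (residue_ring (int p)) (p - 1) 1"
proof -
  have p: "1 < p" using assms prime_gt_1_nat unfolding residues_prime_def by blast
  note U = residue_ring_prime_Units[OF assms]
  have N: "carrier (residue_ring (int p)) - Units (residue_ring (int p)) = {0}"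
    using p unfolding U by (auto simp: residue_ring_def)
  have "cring (residue_ring (int p))" using residue_ring_cring p by simp
  moreover have "card (Units (residue_ring (int p))) = p - 1" using p unfolding U by simp
  ultimately show ?thesis
    unfolding small_principal_local_def N using p by (auto simp: residue_ring_def)
qed

text \<open>\<open>1 + n\<close> is its own inverse and \<open>n\<close> is nilpotent, so the units
  are 1 and \<open>1 + n\<close>, and \<open>n\<close> generates the non-units.\<close>

lemma (in cring) small_principal_local_four_elements:
  assumes n: "n \<in> carrier R" "n \<noteq> \<zero>" "n \<otimes> n = \<zero>" and two: "\<one> \<oplus> \<one> = \<zero> \<or> \<one> \<oplus> \<one> = n"
    and c: "carrier R = {\<zero>, \<one>, n, \<one> \<oplus> n}"
  shows "small_principal_local R 2 2"
proof -
  note d = four_elements_distinct[OF n] and nn = two_n_eq_zero[OF n(1,3) two]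
  have "(\<one> \<oplus> n) \<otimes> (\<one> \<oplus> n) = \<one> \<oplus> (n \<oplus> n) \<oplus> n \<otimes> n" using n(1) by algebra
  then have "\<one> \<oplus> n \<in> Units R" using n nn unfolding Units_def by auto
  moreover have "\<zero> \<notin> Units R" using d(1) by (auto simp: Units_def)
  moreover have "n \<notin> Units R"
  proof
    assume "n \<in> Units R"
    then have "n \<otimes> n \<in> Units R" by simp
    then show False using \<open>\<zero> \<notin> Units R\<close> n(3) by simp
  qed
  moreover have "Units R \<subseteq> {\<zero>, \<one>, n, \<one> \<oplus> n}" using Units_closed unfolding c[symmetric] by blast
  ultimately have U: "Units R = {\<one>, \<one> \<oplus> n}" using Units_one_closed by blast
  have N: "carrier R - Units R = {\<zero>, n}" unfolding U c using d n(2) by auto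
  \<comment> \<open>Each non-unit is paired with its cofactor with respect to
    \<open>n\<close>.\<close>
  have "x = x' \<otimes> n" if "(x, x') \<in> {(\<zero>, \<zero>), (n, \<one>)}" for x x' using that n(1) by auto
  then have "\<forall>x \<in> {\<zero>, n}. \<exists>r \<in> carrier R. x = r \<otimes> n" by blast
  then have "\<exists>p \<in> {\<zero>, n}. \<forall>x \<in> {\<zero>, n}. \<exists>r \<in> carrier R. x = r \<otimes> p" by blast
  moreover have "finite (carrier R)" unfolding c by simp
  moreover have "card (Units R) = 2" "card (carrier R - Units R) = 2"
    unfolding N unfolding U using d n(2) by auto
  ultimately show ?thesis unfolding small_principal_local_def N using is_cring by blast
qed

lemma small_principal_local_residue_ring_4: "small_principal_local (residue_ring 4) 2 2"
proof -
  have "cring (residue_ring 4)" by (simp add: residue_ring_cring)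
  then show ?thesis
    by (rule cring.small_principal_local_four_elements[where n = 2]) (auto simp: residue_ring_def)
qed

lemma small_principal_local_Z2_X_mod_X2: "small_principal_local Z2_X_mod_X2 2 2"
proof -
  obtain n where "dual_numbers Z2_X_mod_X2 n" using dual_numbers_Z2_X_mod_X2 by blast
  then show ?thesis
    using cring.small_principal_local_four_elements[of Z2_X_mod_X2 n] unfolding dual_numbers_def by blast
qed

text \<open>The spider: the complement of the \<open>k\<close>-th coordinate goes to the inner edge \<open>{0, k}\<close> and
  the \<open>k\<close>-th unit vector to the outer edge \<open>{k, k + 3}\<close>; zero goes to an isolated edge.\<close>
lemma complement_of_line_graph_Z2_cubed:
  "complement_of_line_graph (upper_ideal_relation_graph
    (RDirProd (residue_ring 2) (RDirProd (residue_ring 2) (residue_ring 2))))"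
proof -
  let ?F = "residue_ring 2"
  let ?G = "RDirProd ?F ?F"
  let ?R = "RDirProd ?F ?G"
  have F: "cring ?F" by (simp add: residue_ring_cring)
  have G: "cring ?G" by (rule RDirProd_cring[OF F F])
  interpret cring ?R by (rule RDirProd_cring[OF F G])
  have carrier: "carrier ?F = {0, 1}" unfolding residue_ring_def by auto
  have U: "Units ?F = {1}"
    using residue_ring_prime_Units[of 2] by (simp add: residues_prime_def)
  have loc: "small_principal_local ?F 1 1"
    using small_principal_local_residue_ring_prime[of 2] by (simp add: residues_prime_def)
  have adj: "common_nonunit_divisor ?R (a, b, c) (a', b', c') \<longleftrightarrow>
      (a = 0 \<and> a' = 0) \<or> (b = 0 \<and> b' = 0) \<or> (c = 0 \<and> c' = 0)"
    if "a \<in> {0, 1}" "b \<in> {0, 1}" "c \<in> {0, 1}" "a' \<in> {0, 1}" "b' \<in> {0, 1}" "c' \<in> {0, 1}" for a b c a' b' c'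
    using that by (auto simp: RDirProd_common_nonunit_divisor[OF F] F G carrier U
        small_principal_local_common_nonunit_divisor[OF loc])
  have V: "carrier ?R - Units ?R = {(0,0,0), (1,0,0), (0,1,0), (0,0,1), (0,1,1), (1,0,1), (1,1,0)}"
    by (auto simp: Units_RDirProd U carrier)
  \<comment> \<open>For weight 1, \<open>k\<close> is the position of the 1. For weight 2, it is the
    sum of two positions out of 1, 2, 3, so \<open>6 - k\<close> is the position of the 0.\<close>
  define f :: "int \<times> int \<times> int \<Rightarrow> int set" where
    "f = (\<lambda>(a, b, c). let k = a + 2 * b + 3 * c in
      if a + b + c = 0 then {7, 8} else if a + b + c = 1 then {k, k + 3} else {0, 6 - k})"
  have f: "f (0,0,0) = {7, 8}" "f (1,0,0) = {1, 4}" "f (0,1,0) = {2, 5}" "f (0,0,1) = {3, 6}"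
    "f (0,1,1) = {0, 1}" "f (1,0,1) = {0, 2}" "f (1,1,0) = {0, 3}"
    by (simp_all add: f_def)
  show ?thesis
  proof (rule complement_of_line_graph_ringI[where f = f])
    show "inj_on f (carrier ?R - Units ?R)"
      unfolding V by (simp add: inj_on_def f doubleton_eq_iff)
    show "\<exists>p q. p \<noteq> q \<and> f v = {p, q}" if "v \<in> carrier ?R - Units ?R" for v
    proof -
      have "card (f v) = 2" using that unfolding V by (elim insertE emptyE) (simp_all add: f)
      then show ?thesis by (auto simp: card_2_iff)
    qed
    show "common_nonunit_divisor ?R u v \<longleftrightarrow> f u \<inter> f v = {}"
      if "u \<in> carrier ?R - Units ?R" "v \<in> carrier ?R - Units ?R" "u \<noteq> v" for u v
      using that unfolding V by (elim insertE emptyE) (simp_all add: adj f)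
  qed
qed

text \<open>The pairs of local factors meet the bounds \<open>k * l' \<le> 2\<close> and
  \<open>l * k' \<le> 2\<close>. The cube is separate, as its factor \<open>Z_2 \<times> Z_2\<close>
  is not local.\<close>

lemma exceptional_imp_complement_of_line_graph:
  assumes "cring R" "exceptional R"
  shows "complement_of_line_graph (upper_ideal_relation_graph R)"
proof -
  have 2: "small_principal_local (residue_ring 2) 1 1" and 3: "small_principal_local (residue_ring 3) 2 1"
    using small_principal_local_residue_ring_prime[of 2] small_principal_local_residue_ring_prime[of 3]
    by (simp_all add: residues_prime_def)
  note 4 = small_principal_local_residue_ring_4 and D = small_principal_local_Z2_X_mod_X2
  have cring: "cring (residue_ring 2)" "cring (residue_ring 3)" "cring (residue_ring 4)"
    "cring Z2_X_mod_X2"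
    using 2 3 4 D unfolding small_principal_local_def by blast+
  have transfer: "complement_of_line_graph (upper_ideal_relation_graph R)"
    if "R \<simeq> S" "cring S" "complement_of_line_graph (upper_ideal_relation_graph S)"
    for S :: "('x, 'y) ring_scheme"
    using that ring_iso_complement_of_line_graph[OF assms(1)] unfolding is_ring_iso_def by blast
  show ?thesis
    using assms(2) unfolding exceptional_def
  proof (elim disjE)
    assume "R \<simeq> RDirProd (residue_ring 2) (RDirProd (residue_ring 2) (residue_ring 2))"
    then show ?thesis
      by (rule transfer) (intro RDirProd_cring cring complement_of_line_graph_Z2_cubed)+
  next
    assume "R \<simeq> RDirProd (residue_ring 2) (residue_ring 2)"
    then show ?thesis
      by (rule transfer)
        (intro RDirProd_cring cring, simp add: complement_of_line_graph_two_factors[OF 2 2])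
  next
    assume "R \<simeq> RDirProd (residue_ring 2) (residue_ring 3)"
    then show ?thesis
      by (rule transfer)
        (intro RDirProd_cring cring, simp add: complement_of_line_graph_two_factors[OF 2 3])
  next
    assume "R \<simeq> RDirProd (residue_ring 2) (residue_ring 4)"
    then show ?thesis
      by (rule transfer)
        (intro RDirProd_cring cring, simp add: complement_of_line_graph_two_factors[OF 2 4])
  next
    assume "R \<simeq> RDirProd (residue_ring 2) Z2_X_mod_X2"
    then show ?thesis
      by (rule transfer)
        (intro RDirProd_cring cring, simp add: complement_of_line_graph_two_factors[OF 2 D])
  next
    assume "R \<simeq> RDirProd (residue_ring 3) (residue_ring 3)"
    then show ?thesis
      by (rule transfer)
        (intro RDirProd_cring cring, simp add: complement_of_line_graph_two_factors[OF 3 3])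
  qed
qed

text \<open>\<open>\<one> \<noteq> \<zero>\<close> excludes the zero ring: it has no maximal ideal,
  so it is not local in the sense of \<open>is_local_ring\<close>, and its empty graph is trivially
  the complement of a line graph.\<close>

theorem theorem3p1:
  fixes R :: "('a, 'b) ring_scheme" (structure)
  assumes "artinian_cring R"
    and "\<one> \<noteq> \<zero>"
    and "\<not> is_local_ring R"
  shows "complement_of_line_graph (upper_ideal_relation_graph R) \<longleftrightarrow>
    R \<simeq> RDirProd (residue_ring 2) (RDirProd (residue_ring 2) (residue_ring 2)) \<or>
    R \<simeq> RDirProd (residue_ring 2) (residue_ring 2) \<or>
    R \<simeq> RDirProd (residue_ring 2) (residue_ring 3) \<or>
    R \<simeq> RDirProd (residue_ring 2) (residue_ring 4) \<or>
    R \<simeq> RDirProd (residue_ring 2) Z2_X_mod_X2 \<or>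
    R \<simeq> RDirProd (residue_ring 3) (residue_ring 3)"
proof -
  interpret artinian_cring R by fact
  show ?thesis
    using complement_of_line_graph_imp_exceptional[OF assms(2,3)]
      exceptional_imp_complement_of_line_graph[OF is_cring]
    unfolding exceptional_def by blast
qed

end
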